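(* Let $T$ be a small, binary complete first-order theory in a countable language, with monster model $M$, without the strict order property, and let $p\in S_1(\emptyset)$ be a powerful type. Suppose that $\phi(x,y)=\bigvee_{i=1}^n\phi_i(x,y)$, where each $\phi_i(x,y)$ is $p$-principal, witnesses PGPIP for $p$. Then $n\geq 2$ and $CB(S_{p,p}(\emptyset))<n^2$.
   Context: $T$ is small if $S(\emptyset)$ is countable; binary if every formula is equivalent modulo $T$ to a Boolean combination of formulas with at most two free variables. Write $a\to^{\psi}b$ if $\models\psi(a,b)$ and $\psi(a,y)\vdash\mathrm{tp}(b)$, $a\to b$ if $a\to^\psi b$ for some $L$-formula $\psi$, and $a\mapsto^{\psi}b$ if $a\to^\psi b$ and not $b\to a$. A type $p$ is powerful if it is non-isolated and the model prime over a realization of $p$ is weakly saturated (realizes all finitary types over $\emptyset$). An $L$-formula $\psi(x,y)$ is $p$-principal if for some (any) $a\models p$, $\psi(a,y)$ isolates an extension of $p$ in $S_1(a)$ and $a\mapsto^{\psi}b$ for all $b\in\psi(a,M)$. A formula $\phi(x,y)$ witnesses PGPIP for $p$ if it is a disjunction of $p$-principal formulas, the relation defined by $\phi$ on $p(M)$ is an acyclic digraph, and for all $a,b\in p(M)$ there is $d\models p$ such that $\mathrm{tp}(ab/d)$ is isolated and $\models\phi(d,a)\wedge\phi(d,b)$. $S_{p,p}(\emptyset)$ is the space of complete types in $S_2(\emptyset)$ extending $p(x)\cup p(y)$, and $CB$ denotes its Cantor–Bendixson rank. *)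

theory Defs
  imports "HOL-Analysis.Abstract_Topology" "HOL-Analysis.Product_Topology"
    "HOL-Library.Extended_Nat" "HOL-Combinatorics.Transposition"
begin

unbundle cardinal_syntax

subsection \<open>First-order languages, formulas and structures\<close>

record ('f, 'r) lang =
  Funs :: "'f set"
  Rels :: "'r set"
  far :: "'f \<Rightarrow> nat"
  rar :: "'r \<Rightarrow> nat"

definition countable_lang :: "('f, 'r) lang \<Rightarrow> bool" where
  "countable_lang L \<longleftrightarrow> countable (Funs L) \<and> countable (Rels L)"

datatype 'f tm = Var nat | Fn 'f "'f tm list"

datatype ('f, 'r) fm =
    Fls
  | Eq "'f tm" "'f tm"
  | Rel 'r "'f tm list"
  | Neg "('f, 'r) fm"
  | Or "('f, 'r) fm" "('f, 'r) fm"
  | Ex nat "('f, 'r) fm"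

primrec Disj :: "('f, 'r) fm list \<Rightarrow> ('f, 'r) fm" where
  "Disj [] = Fls"
| "Disj (\<phi> # \<phi>s) = (if \<phi>s = [] then \<phi> else Or \<phi> (Disj \<phi>s))"

fun wf_tm :: "('f, 'r) lang \<Rightarrow> 'f tm \<Rightarrow> bool" where
  "wf_tm L (Var x) = True"
| "wf_tm L (Fn f ts) = (f \<in> Funs L \<and> length ts = far L f \<and> (\<forall>t\<in>set ts. wf_tm L t))"

fun wf_fm :: "('f, 'r) lang \<Rightarrow> ('f, 'r) fm \<Rightarrow> bool" where
  "wf_fm L Fls = True"
| "wf_fm L (Eq s t) = (wf_tm L s \<and> wf_tm L t)"
| "wf_fm L (Rel r ts) = (r \<in> Rels L \<and> length ts = rar L r \<and> (\<forall>t\<in>set ts. wf_tm L t))"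
| "wf_fm L (Neg \<phi>) = wf_fm L \<phi>"
| "wf_fm L (Or \<phi> \<psi>) = (wf_fm L \<phi> \<and> wf_fm L \<psi>)"
| "wf_fm L (Ex x \<phi>) = wf_fm L \<phi>"

fun fv_tm :: "'f tm \<Rightarrow> nat set" where
  "fv_tm (Var x) = {x}"
| "fv_tm (Fn f ts) = (\<Union>t\<in>set ts. fv_tm t)"

fun fv :: "('f, 'r) fm \<Rightarrow> nat set" where
  "fv Fls = {}"
| "fv (Eq s t) = fv_tm s \<union> fv_tm t"
| "fv (Rel r ts) = (\<Union>t\<in>set ts. fv_tm t)"
| "fv (Neg \<phi>) = fv \<phi>"
| "fv (Or \<phi> \<psi>) = fv \<phi> \<union> fv \<psi>"
| "fv (Ex x \<phi>) = fv \<phi> - {x}"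

text \<open>Renaming acts on free and bound variables alike, so for a bijection \<open>\<pi>\<close> there is no
  capture and the result is the substitution instance up to renaming of bound variables.\<close>

fun ren_tm :: "(nat \<Rightarrow> nat) \<Rightarrow> 'f tm \<Rightarrow> 'f tm" where
  "ren_tm \<pi> (Var x) = Var (\<pi> x)"
| "ren_tm \<pi> (Fn f ts) = Fn f (map (ren_tm \<pi>) ts)"

fun ren :: "(nat \<Rightarrow> nat) \<Rightarrow> ('f, 'r) fm \<Rightarrow> ('f, 'r) fm" where
  "ren \<pi> Fls = Fls"
| "ren \<pi> (Eq s t) = Eq (ren_tm \<pi> s) (ren_tm \<pi> t)"
| "ren \<pi> (Rel r ts) = Rel r (map (ren_tm \<pi>) ts)"
| "ren \<pi> (Neg \<phi>) = Neg (ren \<pi> \<phi>)"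
| "ren \<pi> (Or \<phi> \<psi>) = Or (ren \<pi> \<phi>) (ren \<pi> \<psi>)"
| "ren \<pi> (Ex x \<phi>) = Ex (\<pi> x) (ren \<pi> \<phi>)"

text \<open>\<open>fms L n\<close>: the \<open>L\<close>-formulas whose free variables are among \<open>0, \<dots>, n - 1\<close>.\<close>

definition fms :: "('f, 'r) lang \<Rightarrow> nat \<Rightarrow> ('f, 'r) fm set" where
  "fms L n = {\<phi>. wf_fm L \<phi> \<and> fv \<phi> \<subseteq> {..<n}}"

record ('a, 'f, 'r) struct =
  Dom :: "'a set"
  FunI :: "'f \<Rightarrow> 'a list \<Rightarrow> 'a"
  RelI :: "'r \<Rightarrow> 'a list \<Rightarrow> bool"

definition is_struct :: "('f, 'r) lang \<Rightarrow> ('a, 'f, 'r) struct \<Rightarrow> bool" where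
  "is_struct L M \<longleftrightarrow> Dom M \<noteq> {} \<and>
     (\<forall>f\<in>Funs L. \<forall>xs. set xs \<subseteq> Dom M \<and> length xs = far L f \<longrightarrow> FunI M f xs \<in> Dom M)"

fun eval :: "('a, 'f, 'r) struct \<Rightarrow> (nat \<Rightarrow> 'a) \<Rightarrow> 'f tm \<Rightarrow> 'a" where
  "eval M e (Var x) = e x"
| "eval M e (Fn f ts) = FunI M f (map (eval M e) ts)"

fun sat :: "('a, 'f, 'r) struct \<Rightarrow> (nat \<Rightarrow> 'a) \<Rightarrow> ('f, 'r) fm \<Rightarrow> bool" where
  "sat M e Fls = False"
| "sat M e (Eq s t) = (eval M e s = eval M e t)"
| "sat M e (Rel r ts) = RelI M r (map (eval M e) ts)"
| "sat M e (Neg \<phi>) = (\<not> sat M e \<phi>)"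
| "sat M e (Or \<phi> \<psi>) = (sat M e \<phi> \<or> sat M e \<psi>)"
| "sat M e (Ex x \<phi>) = (\<exists>a\<in>Dom M. sat M (e(x := a)) \<phi>)"

text \<open>Truth of \<open>\<phi>(xs)\<close> for a tuple \<open>xs\<close>. Only used for \<open>\<phi> \<in> fms L (length xs)\<close>, where the
  unspecified values of \<open>nth xs\<close> beyond the length of \<open>xs\<close> are irrelevant.\<close>

definition holds :: "('a, 'f, 'r) struct \<Rightarrow> ('f, 'r) fm \<Rightarrow> 'a list \<Rightarrow> bool" where
  "holds M \<phi> xs \<longleftrightarrow> sat M (nth xs) \<phi>"

definition tuples :: "'a set \<Rightarrow> nat \<Rightarrow> 'a list set" where
  "tuples A n = {xs. set xs \<subseteq> A \<and> length xs = n}"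

subsection \<open>Theories\<close>

definition sentences :: "('f, 'r) lang \<Rightarrow> ('f, 'r) fm set" where
  "sentences L = fms L 0"

definition is_model ::
  "('f, 'r) lang \<Rightarrow> ('f, 'r) fm set \<Rightarrow> ('a, 'f, 'r) struct \<Rightarrow> bool" where
  "is_model L T M \<longleftrightarrow> is_struct L M \<and> (\<forall>\<sigma>\<in>T. \<forall>e. range e \<subseteq> Dom M \<longrightarrow> sat M e \<sigma>)"

text \<open>Logical consequence, tested on the structures whose universe is a subset of the type \<open>'a\<close>.
  For a countable language and infinite \<open>'a\<close> this is full consequence, by
  Loewenheim-Skolem. Below, \<open>'a\<close> is the type of the elements of the monster model.\<close>

definition entails ::
  "'a itself \<Rightarrow> ('f, 'r) lang \<Rightarrow> ('f, 'r) fm set \<Rightarrow> ('f, 'r) fm \<Rightarrow> bool" where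
  "entails _ L T \<phi> \<longleftrightarrow> (\<forall>N :: ('a, 'f, 'r) struct. is_model L T N \<longrightarrow>
     (\<forall>e. range e \<subseteq> Dom N \<longrightarrow> sat N e \<phi>))"

definition complete_theory ::
  "'a itself \<Rightarrow> ('f, 'r) lang \<Rightarrow> ('f, 'r) fm set \<Rightarrow> bool" where
  "complete_theory U L T \<longleftrightarrow> T \<subseteq> sentences L \<and> (\<exists>N :: ('a, 'f, 'r) struct. is_model L T N) \<and>
     (\<forall>\<sigma>\<in>sentences L. entails U L T \<sigma> \<or> entails U L T (Neg \<sigma>))"

inductive_set bool_combs :: "('f, 'r) fm set \<Rightarrow> ('f, 'r) fm set" for F where
  "\<phi> \<in> F \<Longrightarrow> \<phi> \<in> bool_combs F"
| "\<phi> \<in> bool_combs F \<Longrightarrow> Neg \<phi> \<in> bool_combs F"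
| "\<phi> \<in> bool_combs F \<Longrightarrow> \<psi> \<in> bool_combs F \<Longrightarrow> Or \<phi> \<psi> \<in> bool_combs F"

definition Iff :: "('f, 'r) fm \<Rightarrow> ('f, 'r) fm \<Rightarrow> ('f, 'r) fm" where
  "Iff \<phi> \<psi> = Neg (Or (Neg (Or (Neg \<phi>) \<psi>)) (Neg (Or (Neg \<psi>) \<phi>)))"

definition binary_theory ::
  "'a itself \<Rightarrow> ('f, 'r) lang \<Rightarrow> ('f, 'r) fm set \<Rightarrow> bool" where
  "binary_theory U L T \<longleftrightarrow>
     (\<forall>\<phi>. wf_fm L \<phi> \<longrightarrow>
        (\<exists>\<psi>\<in>bool_combs {\<chi>. wf_fm L \<chi> \<and> card (fv \<chi>) \<le> 2}. entails U L T (Iff \<phi> \<psi>)))"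

subsection \<open>Types over parameters in a monster model\<close>

text \<open>An \<open>L(A)\<close>-formula in \<open>n\<close> free variables is a pair \<open>(\<phi>, cs)\<close> with \<open>cs\<close> a tuple from \<open>A\<close>
  that is plugged in for the first variables of \<open>\<phi>\<close>; the remaining \<open>n\<close> variables are the free
  ones. So \<open>(\<psi>, [a])\<close> is \<open>\<psi>(a, y)\<close>, and \<open>L\<close>-formulas are the pairs \<open>(\<phi>, [])\<close>.\<close>

type_synonym ('a, 'f, 'r) pfm = "('f, 'r) fm \<times> 'a list"

definition pfms :: "('f, 'r) lang \<Rightarrow> nat \<Rightarrow> 'a set \<Rightarrow> ('a, 'f, 'r) pfm set" where
  "pfms L n A = {(\<phi>, cs). set cs \<subseteq> A \<and> \<phi> \<in> fms L (length cs + n)}"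

definition pholds :: "('a, 'f, 'r) struct \<Rightarrow> ('a, 'f, 'r) pfm \<Rightarrow> 'a list \<Rightarrow> bool" where
  "pholds M \<chi> xs \<longleftrightarrow> holds M (fst \<chi>) (snd \<chi> @ xs)"

text \<open>\<open>types L M n A\<close> is \<open>S\<^sub>n(A)\<close>.\<close>

definition types ::
  "('f, 'r) lang \<Rightarrow> ('a, 'f, 'r) struct \<Rightarrow> nat \<Rightarrow> 'a set \<Rightarrow> ('a, 'f, 'r) pfm set set" where
  "types L M n A = {q. q \<subseteq> pfms L n A \<and>
     (\<forall>F. finite F \<and> F \<subseteq> q \<longrightarrow> (\<exists>xs\<in>tuples (Dom M) n. \<forall>\<chi>\<in>F. pholds M \<chi> xs)) \<and>
     (\<forall>\<phi> cs. (\<phi>, cs) \<in> pfms L n A \<longrightarrow> (\<phi>, cs) \<in> q \<or> (Neg \<phi>, cs) \<in> q)}"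

definition tp ::
  "('f, 'r) lang \<Rightarrow> ('a, 'f, 'r) struct \<Rightarrow> 'a list \<Rightarrow> 'a set \<Rightarrow> ('a, 'f, 'r) pfm set" where
  "tp L M xs A = {\<chi> \<in> pfms L (length xs) A. pholds M \<chi> xs}"

definition realizations ::
  "('a, 'f, 'r) struct \<Rightarrow> nat \<Rightarrow> ('a, 'f, 'r) pfm set \<Rightarrow> 'a list set" where
  "realizations M n q = {xs \<in> tuples (Dom M) n. \<forall>\<chi>\<in>q. pholds M \<chi> xs}"

text \<open>\<open>p(M)\<close> for a 1-type \<open>p\<close>, as a set of elements.\<close>

definition real1 :: "('a, 'f, 'r) struct \<Rightarrow> ('a, 'f, 'r) pfm set \<Rightarrow> 'a set" where
  "real1 M p = {a. [a] \<in> realizations M 1 p}"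

definition isolates ::
  "('a, 'f, 'r) struct \<Rightarrow> nat \<Rightarrow> ('a, 'f, 'r) pfm \<Rightarrow> ('a, 'f, 'r) pfm set \<Rightarrow> bool" where
  "isolates M n \<chi> q \<longleftrightarrow> (\<exists>xs\<in>tuples (Dom M) n. pholds M \<chi> xs) \<and>
     (\<forall>xs\<in>tuples (Dom M) n. pholds M \<chi> xs \<longrightarrow> xs \<in> realizations M n q)"

definition isolated ::
  "('f, 'r) lang \<Rightarrow> ('a, 'f, 'r) struct \<Rightarrow> nat \<Rightarrow> 'a set \<Rightarrow> ('a, 'f, 'r) pfm set \<Rightarrow> bool" where
  "isolated L M n A q \<longleftrightarrow> (\<exists>\<chi>\<in>pfms L n A. isolates M n \<chi> q)"

definition elem_map ::
  "('f, 'r) lang \<Rightarrow> ('a, 'f, 'r) struct \<Rightarrow> 'a set \<Rightarrow> ('a \<Rightarrow> 'a) \<Rightarrow> bool" where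
  "elem_map L M A f \<longleftrightarrow> f ` A \<subseteq> Dom M \<and>
     (\<forall>xs \<phi>. set xs \<subseteq> A \<and> \<phi> \<in> fms L (length xs) \<longrightarrow> (holds M \<phi> xs \<longleftrightarrow> holds M \<phi> (map f xs)))"

definition automorphism ::
  "('f, 'r) lang \<Rightarrow> ('a, 'f, 'r) struct \<Rightarrow> ('a \<Rightarrow> 'a) \<Rightarrow> bool" where
  "automorphism L M g \<longleftrightarrow> bij_betw g (Dom M) (Dom M) \<and>
     (\<forall>f\<in>Funs L. \<forall>xs\<in>tuples (Dom M) (far L f). g (FunI M f xs) = FunI M f (map g xs)) \<and>
     (\<forall>r\<in>Rels L. \<forall>xs\<in>tuples (Dom M) (rar L r). RelI M r xs \<longleftrightarrow> RelI M r (map g xs))"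

text \<open>A monster model (of a countable theory): \<open>\<kappa>\<close>-saturated and strongly \<open>\<kappa>\<close>-homogeneous for
  an uncountable cardinal \<open>\<kappa>\<close>.\<close>

definition monster ::
  "'k rel \<Rightarrow> ('f, 'r) lang \<Rightarrow> ('f, 'r) fm set \<Rightarrow> ('a, 'f, 'r) struct \<Rightarrow> bool" where
  "monster \<kappa> L T M \<longleftrightarrow> is_model L T M \<and> Card_order \<kappa> \<and> natLeq <o \<kappa> \<and>
     (\<forall>A \<subseteq> Dom M. |A| <o \<kappa> \<longrightarrow>
        (\<forall>q\<in>types L M 1 A. realizations M 1 q \<noteq> {}) \<and>
        (\<forall>f. elem_map L M A f \<longrightarrow> (\<exists>g. automorphism L M g \<and> (\<forall>a\<in>A. g a = f a))))"

text \<open>Smallness and the strict order property of the complete theory \<open>T\<close> are read off in its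
  monster model. Definable families \<open>\<phi>(b, x)\<close> have their parameter variables first.\<close>

definition small_theory :: "('f, 'r) lang \<Rightarrow> ('a, 'f, 'r) struct \<Rightarrow> bool" where
  "small_theory L M \<longleftrightarrow> countable (\<Union>n. types L M n {})"

definition SOP :: "('f, 'r) lang \<Rightarrow> ('a, 'f, 'r) struct \<Rightarrow> bool" where
  "SOP L M \<longleftrightarrow> (\<exists>m n. \<exists>\<phi>\<in>fms L (m + n). \<exists>bs :: nat \<Rightarrow> 'a list.
     (\<forall>i. bs i \<in> tuples (Dom M) m) \<and>
     (\<forall>i. {xs \<in> tuples (Dom M) n. holds M \<phi> (bs i @ xs)}
        \<subset> {xs \<in> tuples (Dom M) n. holds M \<phi> (bs (Suc i) @ xs)}))"

subsection \<open>Prime models and powerful types\<close>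

text \<open>As usual with a monster model, models are elementary substructures of \<open>M\<close>, given by their
  universes.\<close>

definition restr :: "('a, 'f, 'r) struct \<Rightarrow> 'a set \<Rightarrow> ('a, 'f, 'r) struct" where
  "restr M B = M\<lparr>Dom := B\<rparr>"

definition elem_sub :: "('f, 'r) lang \<Rightarrow> ('a, 'f, 'r) struct \<Rightarrow> 'a set \<Rightarrow> bool" where
  "elem_sub L M B \<longleftrightarrow> B \<subseteq> Dom M \<and> is_struct L (restr M B) \<and>
     (\<forall>\<phi> e. wf_fm L \<phi> \<and> range e \<subseteq> B \<longrightarrow> (sat (restr M B) e \<phi> \<longleftrightarrow> sat M e \<phi>))"

definition elem_embedding ::
  "('f, 'r) lang \<Rightarrow> ('a, 'f, 'r) struct \<Rightarrow> ('a, 'f, 'r) struct \<Rightarrow> ('a \<Rightarrow> 'a) \<Rightarrow> bool" where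
  "elem_embedding L N N' f \<longleftrightarrow> f ` Dom N \<subseteq> Dom N' \<and>
     (\<forall>\<phi> e. wf_fm L \<phi> \<and> range e \<subseteq> Dom N \<longrightarrow> (sat N e \<phi> \<longleftrightarrow> sat N' (f \<circ> e) \<phi>))"

definition prime_over ::
  "('f, 'r) lang \<Rightarrow> ('a, 'f, 'r) struct \<Rightarrow> 'a set \<Rightarrow> 'a set \<Rightarrow> bool" where
  "prime_over L M A B \<longleftrightarrow> elem_sub L M B \<and> A \<subseteq> B \<and>
     (\<forall>C. elem_sub L M C \<and> A \<subseteq> C \<longrightarrow>
        (\<exists>f. elem_embedding L (restr M B) (restr M C) f \<and> (\<forall>a\<in>A. f a = a)))"

definition weakly_saturated :: "('f, 'r) lang \<Rightarrow> ('a, 'f, 'r) struct \<Rightarrow> 'a set \<Rightarrow> bool" where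
  "weakly_saturated L M B \<longleftrightarrow> (\<forall>n. \<forall>q\<in>types L M n {}. realizations (restr M B) n q \<noteq> {})"

definition powerful ::
  "('f, 'r) lang \<Rightarrow> ('a, 'f, 'r) struct \<Rightarrow> nat \<Rightarrow> ('a, 'f, 'r) pfm set \<Rightarrow> bool" where
  "powerful L M n p \<longleftrightarrow> p \<in> types L M n {} \<and> \<not> isolated L M n {} p \<and>
     (\<exists>xs\<in>realizations M n p. \<exists>B. prime_over L M (set xs) B \<and> weakly_saturated L M B)"

subsection \<open>Semi-isolation, principal formulas and PGPIP\<close>

definition semi_isol ::
  "('f, 'r) lang \<Rightarrow> ('a, 'f, 'r) struct \<Rightarrow> ('f, 'r) fm \<Rightarrow> 'a \<Rightarrow> 'a \<Rightarrow> bool" where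
  "semi_isol L M \<psi> a b \<longleftrightarrow> holds M \<psi> [a, b] \<and>
     (\<forall>c\<in>Dom M. holds M \<psi> [a, c] \<longrightarrow> c \<in> real1 M (tp L M [b] {}))"

definition arrow :: "('f, 'r) lang \<Rightarrow> ('a, 'f, 'r) struct \<Rightarrow> 'a \<Rightarrow> 'a \<Rightarrow> bool" where
  "arrow L M a b \<longleftrightarrow> (\<exists>\<psi>\<in>fms L 2. semi_isol L M \<psi> a b)"

definition strict_arrow ::
  "('f, 'r) lang \<Rightarrow> ('a, 'f, 'r) struct \<Rightarrow> ('f, 'r) fm \<Rightarrow> 'a \<Rightarrow> 'a \<Rightarrow> bool" where
  "strict_arrow L M \<psi> a b \<longleftrightarrow> semi_isol L M \<psi> a b \<and> \<not> arrow L M b a"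

definition principal ::
  "('f, 'r) lang \<Rightarrow> ('a, 'f, 'r) struct \<Rightarrow> ('a, 'f, 'r) pfm set \<Rightarrow> ('f, 'r) fm \<Rightarrow> bool" where
  "principal L M p \<psi> \<longleftrightarrow> \<psi> \<in> fms L 2 \<and>
     (\<exists>a\<in>real1 M p.
        (\<exists>q\<in>types L M 1 {a}. p \<subseteq> q \<and> isolates M 1 (\<psi>, [a]) q) \<and>
        (\<forall>b\<in>Dom M. holds M \<psi> [a, b] \<longrightarrow> strict_arrow L M \<psi> a b))"

definition witnesses_PGPIP ::
  "('f, 'r) lang \<Rightarrow> ('a, 'f, 'r) struct \<Rightarrow> ('a, 'f, 'r) pfm set \<Rightarrow> ('f, 'r) fm \<Rightarrow> bool" where
  "witnesses_PGPIP L M p \<phi> \<longleftrightarrow>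
     (\<exists>\<phi>s. (\<forall>\<psi>\<in>set \<phi>s. principal L M p \<psi>) \<and> \<phi> = Disj \<phi>s) \<and>
     acyclic {(a, b). a \<in> real1 M p \<and> b \<in> real1 M p \<and> holds M \<phi> [a, b]} \<and>
     (\<forall>a\<in>real1 M p. \<forall>b\<in>real1 M p. \<exists>d\<in>real1 M p.
        isolated L M 2 {d} (tp L M [a, b] {d}) \<and> holds M \<phi> [d, a] \<and> holds M \<phi> [d, b])"

subsection \<open>The space of pairs of realizations and its Cantor--Bendixson rank\<close>

definition type_space ::
  "('f, 'r) lang \<Rightarrow> ('a, 'f, 'r) struct \<Rightarrow> nat \<Rightarrow> 'a set \<Rightarrow> ('a, 'f, 'r) pfm set topology" where
  "type_space L M n A =
     topology_generated_by ((\<lambda>\<chi>. {q \<in> types L M n A. \<chi> \<in> q}) ` pfms L n A)"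

text \<open>\<open>p(y)\<close> is obtained from \<open>p(x)\<close> by exchanging the variables \<open>x = 0\<close> and \<open>y = 1\<close>.\<close>

definition pair_space ::
  "('f, 'r) lang \<Rightarrow> ('a, 'f, 'r) struct \<Rightarrow> ('a, 'f, 'r) pfm set \<Rightarrow>
    ('a, 'f, 'r) pfm set topology" where
  "pair_space L M p = subtopology (type_space L M 2 {})
     {q \<in> types L M 2 {}. p \<union> (\<lambda>(\<phi>, cs). (ren (transpose 0 1) \<phi>, cs)) ` p \<subseteq> q}"

definition cb_derivative :: "'b topology \<Rightarrow> nat \<Rightarrow> 'b set" where
  "cb_derivative X k = ((\<lambda>S. S \<inter> X derived_set_of S) ^^ k) (topspace X)"

text \<open>A point has rank at least \<open>k\<close> iff it lies in the \<open>k\<close>-th derivative; the rank of the space is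
  the supremum of the ranks of its points, i.e. for a nonempty compact scattered space the last
  \<open>k\<close> such that the \<open>k\<close>-th derivative is nonempty. All infinite ranks (and the value for a
  non-scattered space) are collapsed to \<open>\<infinity>\<close>.\<close>

definition cb_rank :: "'b topology \<Rightarrow> enat" where
  "cb_rank X = (SUP k\<in>{k. cb_derivative X k \<noteq> {}}. enat k)"

end

theory Submission
  imports Defs
begin

text \<open>For \<open>1 \<le> i, j \<le> n\<close> let \<open>C\<^sub>i\<^sub>j\<close> be the set of types \<open>tp(a, b)\<close> such that
  \<open>\<phi>\<^sub>i(d, a)\<close> and \<open>\<phi>\<^sub>j(d, b)\<close> hold for some \<open>d\<close> realizing \<open>p\<close>. By saturation
  \<open>C\<^sub>i\<^sub>j\<close> is closed. By binarity, an isolated type of \<open>(a, b)\<close> over such a \<open>d\<close> is isolated by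
  \<open>\<phi>\<^sub>i(d, x) \<and> \<phi>\<^sub>j(d, y) \<and> \<theta>(x, y)\<close> for some \<open>\<theta>\<close> without parameters, so PGPIP says that
  every \<open>q\<close> in \<open>S\<^sub>p\<^sub>,\<^sub>p\<close> is an isolated point of some \<open>C\<^sub>i\<^sub>j\<close> to which it belongs. Hence the other
  points of a small neighbourhood of \<open>q\<close> lie in strictly fewer of the \<open>n\<^sup>2\<close> sets \<open>C\<^sub>i\<^sub>j\<close> than \<open>q\<close>
  does, which bounds the rank. If \<open>n = 1\<close>, then all of \<open>S\<^sub>p\<^sub>,\<^sub>p\<close> is isolated, hence finite, so
  semi-isolation is a definable quasi-order on the realizations of \<open>p\<close>; it has infinite strict
  chains, which contradicts the failure of the strict order property.\<close>

subsection \<open>Satisfaction and renaming of variables\<close>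

lemma eval_cong:
  "(\<And>x. x \<in> fv_tm t \<Longrightarrow> e x = e' x) \<Longrightarrow> eval M e t = eval M e' t"
proof (induction t)
  case (Fn f ts)
  then have "map (eval M e) ts = map (eval M e') ts" by (auto intro!: map_cong)
  then show ?case by (simp del: map_eq_conv)
qed simp

lemma sat_cong:
  "(\<And>x. x \<in> fv \<phi> \<Longrightarrow> e x = e' x) \<Longrightarrow> sat M e \<phi> \<longleftrightarrow> sat M e' \<phi>"
proof (induction \<phi> arbitrary: e e')
  case (Eq s t)
  then show ?case using eval_cong[of s e e' M] eval_cong[of t e e' M] by auto
next
  case (Rel r ts)
  then have "map (eval M e) ts = map (eval M e') ts"
    by (auto intro!: map_cong eval_cong)
  then show ?case by (simp del: map_eq_conv)
next
  case (Neg \<phi>)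
  have "sat M e \<phi> \<longleftrightarrow> sat M e' \<phi>" by (rule Neg.IH) (simp add: Neg.prems)
  then show ?case by simp
next
  case (Or \<phi> \<psi>)
  have "sat M e \<phi> \<longleftrightarrow> sat M e' \<phi>" by (rule Or.IH(1)) (simp add: Or.prems)
  moreover have "sat M e \<psi> \<longleftrightarrow> sat M e' \<psi>" by (rule Or.IH(2)) (simp add: Or.prems)
  ultimately show ?case by simp
next
  case (Ex x \<phi>)
  have "sat M (e(x := a)) \<phi> \<longleftrightarrow> sat M (e'(x := a)) \<phi>" for a
    by (rule Ex.IH) (simp add: Ex.prems)
  then show ?case by simp
qed simp

lemma finite_fv_tm: "finite (fv_tm t)"
  by (induction t) auto

lemma finite_fv: "finite (fv \<phi>)"
  by (induction \<phi>) (auto simp: finite_fv_tm)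

lemma eval_ren_tm: "eval M e (ren_tm \<rho> t) = eval M (\<lambda>y. e (\<rho> y)) t"
proof (induction t)
  case (Fn f ts)
  then have "map (eval M e \<circ> ren_tm \<rho>) ts = map (eval M (\<lambda>y. e (\<rho> y))) ts" by simp
  then show ?case by (simp del: map_eq_conv)
qed simp

lemma fv_ren_tm: "fv_tm (ren_tm \<rho> t) = \<rho> ` fv_tm t"
  by (induction t) auto

lemma wf_ren_tm: "wf_tm L (ren_tm \<rho> t) \<longleftrightarrow> wf_tm L t"
  by (induction t) auto

text \<open>\<open>ren\<close> renames bound variables too; injectivity keeps the value given to
  \<open>\<rho> x\<close> from being read by any other variable.\<close>

lemma sat_ren:
  assumes "inj \<rho>"
  shows "sat M e (ren \<rho> \<phi>) \<longleftrightarrow> sat M (\<lambda>y. e (\<rho> y)) \<phi>"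
proof (induction \<phi> arbitrary: e)
  case (Rel r ts)
  have "map (eval M e \<circ> ren_tm \<rho>) ts = map (eval M (\<lambda>y. e (\<rho> y))) ts" by (simp add: eval_ren_tm)
  then show ?case by (simp del: map_eq_conv)
next
  case (Ex x \<phi>)
  have "(\<lambda>y. (e(\<rho> x := a)) (\<rho> y)) = (\<lambda>y. e (\<rho> y))(x := a)" for a
    using assms by (auto simp: fun_eq_iff inj_eq)
  then show ?case by (simp add: Ex.IH)
qed (auto simp: eval_ren_tm)

text \<open>Substitution along a map that may identify variables, where \<open>ren\<close> could
  capture. The induction runs over all \<open>\<rho>\<close>, so at a quantifier the bound variable
  can be redirected to a fresh \<open>z\<close>.\<close>

lemma ex_substitution:
  "\<exists>\<phi>'. (wf_fm L \<phi> \<longrightarrow> wf_fm L \<phi>') \<and> fv \<phi>' \<subseteq> \<rho> ` fv \<phi> \<and>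
     (\<forall>e. sat M e \<phi>' \<longleftrightarrow> sat M (\<lambda>y. e (\<rho> y)) \<phi>)"
proof (induction \<phi> arbitrary: \<rho>)
  case Fls
  then show ?case by (intro exI[of _ Fls]) simp
next
  case (Eq s t)
  then show ?case
    by (intro exI[of _ "Eq (ren_tm \<rho> s) (ren_tm \<rho> t)"])
      (auto simp: eval_ren_tm wf_ren_tm fv_ren_tm)
next
  case (Rel r ts)
  have "map (eval M e \<circ> ren_tm \<rho>) ts = map (eval M (\<lambda>y. e (\<rho> y))) ts" for e
    by (simp add: eval_ren_tm)
  then show ?case
    by (intro exI[of _ "Rel r (map (ren_tm \<rho>) ts)"])
      (auto simp: wf_ren_tm fv_ren_tm simp del: map_eq_conv)
next
  case (Neg \<phi>)
  then obtain \<phi>' where "(wf_fm L \<phi> \<longrightarrow> wf_fm L \<phi>') \<and> fv \<phi>' \<subseteq> \<rho> ` fv \<phi> \<and>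
      (\<forall>e. sat M e \<phi>' \<longleftrightarrow> sat M (\<lambda>y. e (\<rho> y)) \<phi>)" by blast
  then show ?case by (intro exI[of _ "Neg \<phi>'"]) simp
next
  case (Or \<phi> \<psi>)
  obtain \<phi>' where "(wf_fm L \<phi> \<longrightarrow> wf_fm L \<phi>') \<and> fv \<phi>' \<subseteq> \<rho> ` fv \<phi> \<and>
      (\<forall>e. sat M e \<phi>' \<longleftrightarrow> sat M (\<lambda>y. e (\<rho> y)) \<phi>)" using Or.IH(1) by blast
  moreover obtain \<psi>' where "(wf_fm L \<psi> \<longrightarrow> wf_fm L \<psi>') \<and> fv \<psi>' \<subseteq> \<rho> ` fv \<psi> \<and>
      (\<forall>e. sat M e \<psi>' \<longleftrightarrow> sat M (\<lambda>y. e (\<rho> y)) \<psi>)" using Or.IH(2) by blast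
  ultimately show ?case by (intro exI[of _ "Or \<phi>' \<psi>'"]) auto
next
  case (Ex x \<phi>)
  obtain z where z: "z \<notin> \<rho> ` fv \<phi>"
    using ex_new_if_finite[of "\<rho> ` fv \<phi>"] by (auto simp: finite_fv)
  obtain \<phi>' where \<phi>': "wf_fm L \<phi> \<longrightarrow> wf_fm L \<phi>'" "fv \<phi>' \<subseteq> (\<rho>(x := z)) ` fv \<phi>"
      "\<And>e. sat M e \<phi>' \<longleftrightarrow> sat M (\<lambda>y. e ((\<rho>(x := z)) y)) \<phi>" using Ex.IH by blast
  have "sat M (\<lambda>y. (e(z := a)) ((\<rho>(x := z)) y)) \<phi> \<longleftrightarrow> sat M ((\<lambda>y. e (\<rho> y))(x := a)) \<phi>" for e a
    by (rule sat_cong) (use z in auto)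
  moreover have "fv \<phi>' - {z} \<subseteq> \<rho> ` (fv \<phi> - {x})" using \<phi>'(2) by (auto split: if_splits)
  ultimately show ?case using \<phi>' by (intro exI[of _ "Ex z \<phi>'"]) simp
qed

lemma sat_Disj: "sat M e (Disj \<psi>s) \<longleftrightarrow> (\<exists>\<psi>\<in>set \<psi>s. sat M e \<psi>)"
  by (induction \<psi>s) auto

section \<open>Truth at tuples and formulas with few variables\<close>

lemma holds_Disj: "holds M (Disj \<psi>s) xs \<longleftrightarrow> (\<exists>\<psi>\<in>set \<psi>s. holds M \<psi> xs)"
  by (simp add: holds_def sat_Disj)

text \<open>Past the length of \<open>xs\<close> the values of \<open>nth xs\<close> are unspecified
  and may leave the universe. This permits a change to an assignment with range in
  \<open>Dom M\<close>, as \<open>dfn\<close> requires.\<close>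

lemma holds_iff_sat:
  assumes "\<phi> \<in> fms L (length xs)" "\<And>i. i < length xs \<Longrightarrow> e i = xs ! i"
  shows "holds M \<phi> xs \<longleftrightarrow> sat M e \<phi>"
  unfolding holds_def by (rule sat_cong) (use assms in \<open>auto simp: fms_def\<close>)

lemma tuples_1: "xs \<in> tuples A 1 \<longleftrightarrow> (\<exists>a\<in>A. xs = [a])"
  by (auto simp: tuples_def length_Suc_conv)

lemma tuples_2: "xs \<in> tuples A 2 \<longleftrightarrow> (\<exists>a\<in>A. \<exists>b\<in>A. xs = [a, b])"
  by (auto simp: tuples_def length_Suc_conv numeral_2_eq_2)

lemma fms_mono: "m \<le> n \<Longrightarrow> \<phi> \<in> fms L m \<Longrightarrow> \<phi> \<in> fms L n"
  by (force simp: fms_def)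

lemma Neg_in_fms: "Neg \<phi> \<in> fms L n \<longleftrightarrow> \<phi> \<in> fms L n"
  by (simp add: fms_def)

lemma pfms_emptyI: "\<phi> \<in> fms L n \<Longrightarrow> (\<phi>, []) \<in> pfms L n {}"
  by (simp add: pfms_def)

lemma pfms_emptyE:
  assumes "\<chi> \<in> pfms L n {}"
  obtains \<phi> where "\<phi> \<in> fms L n" "\<chi> = (\<phi>, [])"
  using assms by (auto simp: pfms_def)

subsection \<open>Bounding the Cantor--Bendixson rank\<close>

text \<open>A point of the \<open>(k + 1)\<close>-st derivative is a limit of points of the
  \<open>k\<close>-th, and nearby points other than itself carry strictly smaller label sets. So
  lying in the \<open>k\<close>-th derivative takes more than \<open>k\<close> labels; the case
  \<open>k = 0\<close> is the nonemptiness of \<open>K x\<close>.\<close>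

lemma cb_rank_less_card:
  assumes "finite I" "I \<noteq> {}"
    and K: "\<And>x. x \<in> topspace X \<Longrightarrow> K x \<noteq> {}" "\<And>x. K x \<subseteq> I"
    and nbhd: "\<And>x. x \<in> topspace X \<Longrightarrow>
      \<exists>U. openin X U \<and> x \<in> U \<and> (\<forall>y\<in>U. y \<noteq> x \<longrightarrow> K y \<subset> K x)"
  shows "cb_rank X < enat (card I)"
proof -
  have fin: "finite (K x)" for x using assms(1) K(2) by (rule finite_subset[rotated])
  have deriv: "x \<in> topspace X \<and> k < card (K x)" if "x \<in> cb_derivative X k" for x k
    using that
  proof (induction k arbitrary: x)
    case 0
    then have "x \<in> topspace X" by (simp add: cb_derivative_def)
    then show ?case using K(1) fin by (simp add: card_gt_0_iff)
  next
    case (Suc k)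
    let ?S = "cb_derivative X k"
    have "cb_derivative X (Suc k) = ?S \<inter> X derived_set_of ?S" by (simp add: cb_derivative_def)
    then have x: "x \<in> ?S" "x \<in> X derived_set_of ?S" using Suc.prems by blast+
    then have xX: "x \<in> topspace X" using Suc.IH by blast
    then obtain U where U: "openin X U" "x \<in> U" "\<forall>y\<in>U. y \<noteq> x \<longrightarrow> K y \<subset> K x"
      using nbhd by blast
    then obtain y where y: "y \<noteq> x" "y \<in> ?S" "y \<in> U"
      using x(2) unfolding in_derived_set_of by blast
    then have "K y \<subset> K x" using U(3) by blast
    then have "card (K y) < card (K x)" by (rule psubset_card_mono[OF fin])
    moreover have "k < card (K y)" using Suc.IH y(2) by blast
    ultimately show ?case using xX by simp
  qed
  \<comment> \<open>\<open>SUP_least\<close> gives only a weak inequality, so strictness is secured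
    by bounding each \<open>k\<close> by \<open>card I - 1\<close>.\<close>
  have "cb_rank X \<le> enat (card I - 1)" unfolding cb_rank_def
  proof (rule SUP_least)
    fix k assume "k \<in> {k. cb_derivative X k \<noteq> {}}"
    then obtain x where "x \<in> cb_derivative X k" by blast
    then have "k < card (K x)" using deriv by blast
    also have "\<dots> \<le> card I" using K(2) assms(1) by (rule card_mono[rotated])
    finally show "enat k \<le> enat (card I - 1)" by simp
  qed
  also have "\<dots> < enat (card I)" using assms(1,2) by (simp add: card_gt_0_iff)
  finally show ?thesis .
qed

subsection \<open>Definable relations\<close>

text \<open>Definability is stated for predicates on assignments, so that the closure rules below
  build formulas without writing out their syntax. Assignments are restricted to the universe, over
  which \<open>Ex\<close> ranges.\<close>

definition dfn ::
  "('f, 'r) lang \<Rightarrow> ('a, 'f, 'r) struct \<Rightarrow> nat \<Rightarrow> ((nat \<Rightarrow> 'a) \<Rightarrow> bool) \<Rightarrow> bool" where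
  "dfn L M n R \<longleftrightarrow> (\<exists>\<phi>\<in>fms L n. \<forall>e. range e \<subseteq> Dom M \<longrightarrow> (sat M e \<phi> \<longleftrightarrow> R e))"

lemma dfn_sat:
  assumes "wf_fm L \<phi>" "\<rho> ` fv \<phi> \<subseteq> {..<n}"
  shows "dfn L M n (\<lambda>e. sat M (\<lambda>y. e (\<rho> y)) \<phi>)"
proof -
  obtain \<phi>' where "wf_fm L \<phi>'" "fv \<phi>' \<subseteq> \<rho> ` fv \<phi>" "\<And>e. sat M e \<phi>' \<longleftrightarrow> sat M (\<lambda>y. e (\<rho> y)) \<phi>"
    using ex_substitution[of L \<phi> \<rho> M] assms(1) by blast
  then show ?thesis unfolding dfn_def fms_def using assms(2) by blast
qed

lemma dfn_holds:
  assumes "\<phi> \<in> fms L (length is)" "set is \<subseteq> {..<n}"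
  shows "dfn L M n (\<lambda>e. holds M \<phi> (map e is))"
proof -
  have "holds M \<phi> (map e is) \<longleftrightarrow> sat M (\<lambda>i. e (is ! i)) \<phi>" for e
    by (rule holds_iff_sat) (use assms in auto)
  moreover have "dfn L M n (\<lambda>e. sat M (\<lambda>i. e (is ! i)) \<phi>)"
    by (rule dfn_sat) (use assms in \<open>auto simp: fms_def subset_iff\<close>)
  ultimately show ?thesis by simp
qed

lemma dfn_holds1:
  "\<phi> \<in> fms L 1 \<Longrightarrow> i < n \<Longrightarrow> dfn L M n (\<lambda>e. holds M \<phi> [e i])"
  using dfn_holds[of \<phi> L "[i]" n M] by simp

lemma dfn_holds2:
  "\<phi> \<in> fms L 2 \<Longrightarrow> i < n \<Longrightarrow> j < n \<Longrightarrow> dfn L M n (\<lambda>e. holds M \<phi> [e i, e j])"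
  using dfn_holds[of \<phi> L "[i, j]" n M] by (simp add: numeral_2_eq_2)

lemma dfn_holds3:
  "\<phi> \<in> fms L 3 \<Longrightarrow> i < n \<Longrightarrow> j < n \<Longrightarrow> k < n \<Longrightarrow> dfn L M n (\<lambda>e. holds M \<phi> [e i, e j, e k])"
  using dfn_holds[of \<phi> L "[i, j, k]" n M] by (simp add: numeral_3_eq_3)

lemma dfn_False: "dfn L M n (\<lambda>e. False)"
  unfolding dfn_def by (intro bexI[of _ Fls]) (auto simp: fms_def)

lemma dfn_not: "dfn L M n R \<Longrightarrow> dfn L M n (\<lambda>e. \<not> R e)"
  unfolding dfn_def by (metis Neg_in_fms sat.simps(4))

lemma dfn_or:
  assumes "dfn L M n R" "dfn L M n S"
  shows "dfn L M n (\<lambda>e. R e \<or> S e)"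
proof -
  obtain \<phi> \<psi> where "\<phi> \<in> fms L n" "\<forall>e. range e \<subseteq> Dom M \<longrightarrow> (sat M e \<phi> \<longleftrightarrow> R e)"
    "\<psi> \<in> fms L n" "\<forall>e. range e \<subseteq> Dom M \<longrightarrow> (sat M e \<psi> \<longleftrightarrow> S e)"
    using assms unfolding dfn_def by blast
  then show ?thesis unfolding dfn_def by (intro bexI[of _ "Or \<phi> \<psi>"]) (auto simp: fms_def)
qed

lemma dfn_and:
  assumes "dfn L M n R" "dfn L M n S"
  shows "dfn L M n (\<lambda>e. R e \<and> S e)"
  using dfn_not[OF dfn_or[OF dfn_not[OF assms(1)] dfn_not[OF assms(2)]]] by simp

lemma dfn_imp:
  assumes "dfn L M n R" "dfn L M n S"
  shows "dfn L M n (\<lambda>e. R e \<longrightarrow> S e)"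
  using dfn_or[OF dfn_not[OF assms(1)] assms(2)] by simp

lemma dfn_Bex_finite:
  assumes "finite I" "\<And>i. i \<in> I \<Longrightarrow> dfn L M n (\<lambda>e. R e i)"
  shows "dfn L M n (\<lambda>e. \<exists>i\<in>I. R e i)"
  using assms
proof (induction I rule: finite_induct)
  case empty
  then show ?case using dfn_False by simp
next
  case (insert i I)
  then have "dfn L M n (\<lambda>e. R e i \<or> (\<exists>i\<in>I. R e i))" by (intro dfn_or) simp_all
  then show ?case by simp
qed

lemma dfn_Ball_finite:
  assumes "finite I" "\<And>i. i \<in> I \<Longrightarrow> dfn L M n (\<lambda>e. R e i)"
  shows "dfn L M n (\<lambda>e. \<forall>i\<in>I. R e i)"
proof -
  have "dfn L M n (\<lambda>e. \<not> (\<exists>i\<in>I. \<not> R e i))"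
    by (intro dfn_not dfn_Bex_finite assms)
  then show ?thesis by simp
qed

text \<open>Variable \<open>n\<close> is the one to be bound. The second premise says that
  \<open>R\<close> reads it only through its second argument, so overwriting it is harmless.\<close>

lemma dfn_Bex:
  assumes "dfn L M (Suc n) (\<lambda>e. R e (e n))" "\<And>e a b. R (e(n := b)) a \<longleftrightarrow> R e a"
  shows "dfn L M n (\<lambda>e. \<exists>a\<in>Dom M. R e a)"
proof -
  from assms(1) obtain \<phi> where \<phi>: "\<phi> \<in> fms L (Suc n)"
    "\<forall>e. range e \<subseteq> Dom M \<longrightarrow> (sat M e \<phi> \<longleftrightarrow> R e (e n))"
    unfolding dfn_def by (rule bexE)
  have "sat M e (Ex n \<phi>) \<longleftrightarrow> (\<exists>a\<in>Dom M. R e a)" if e: "range e \<subseteq> Dom M" for e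
  proof -
    have "sat M (e(n := a)) \<phi> \<longleftrightarrow> R e a" if "a \<in> Dom M" for a
    proof -
      have "range (e(n := a)) \<subseteq> Dom M" using that e by auto
      then have "sat M (e(n := a)) \<phi> \<longleftrightarrow> R (e(n := a)) a" using \<phi>(2) by simp
      then show ?thesis by (simp only: assms(2))
    qed
    then show ?thesis by simp
  qed
  moreover have "Ex n \<phi> \<in> fms L n"
    using \<phi>(1) by (auto simp: fms_def less_Suc_eq)
  ultimately show ?thesis unfolding dfn_def by (intro bexI[of _ "Ex n \<phi>"] allI impI)
qed

lemma dfn_Ball:
  assumes "dfn L M (Suc n) (\<lambda>e. R e (e n))" "\<And>e a b. R (e(n := b)) a \<longleftrightarrow> R e a"
  shows "dfn L M n (\<lambda>e. \<forall>a\<in>Dom M. R e a)"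
proof -
  have "dfn L M n (\<lambda>e. \<not> (\<exists>a\<in>Dom M. \<not> R e a))"
    by (rule dfn_not, rule dfn_Bex, rule dfn_not, rule assms(1)) (simp add: assms(2))
  then show ?thesis by simp
qed

lemma dfn_1D:
  assumes "dfn L M 1 (\<lambda>e. R (e 0))"
  shows "\<exists>\<phi>\<in>fms L 1. \<forall>a\<in>Dom M. holds M \<phi> [a] \<longleftrightarrow> R a"
proof -
  obtain \<phi> where \<phi>: "\<phi> \<in> fms L 1" "\<And>e. range e \<subseteq> Dom M \<Longrightarrow> sat M e \<phi> \<longleftrightarrow> R (e 0)"
    using assms unfolding dfn_def by blast
  have "holds M \<phi> [a] \<longleftrightarrow> R a" if "a \<in> Dom M" for a
    using holds_iff_sat[of \<phi> L "[a]" "\<lambda>_. a" M] \<phi>(1) \<phi>(2)[of "\<lambda>_. a"] that by auto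
  then show ?thesis using \<phi>(1) by blast
qed

lemma dfn_2D:
  assumes "dfn L M 2 (\<lambda>e. R (e 0) (e 1))"
  shows "\<exists>\<phi>\<in>fms L 2. \<forall>a\<in>Dom M. \<forall>b\<in>Dom M. holds M \<phi> [a, b] \<longleftrightarrow> R a b"
proof -
  obtain \<phi> where \<phi>: "\<phi> \<in> fms L 2" "\<And>e. range e \<subseteq> Dom M \<Longrightarrow> sat M e \<phi> \<longleftrightarrow> R (e 0) (e 1)"
    using assms unfolding dfn_def by blast
  have "holds M \<phi> [a, b] \<longleftrightarrow> R a b" if "a \<in> Dom M" "b \<in> Dom M" for a b
  proof -
    let ?e = "\<lambda>i::nat. if i = 0 then a else b"
    have "holds M \<phi> [a, b] \<longleftrightarrow> sat M ?e \<phi>"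
      by (rule holds_iff_sat) (use \<phi>(1) in \<open>auto simp: less_Suc_eq numeral_2_eq_2\<close>)
    also have "\<dots> \<longleftrightarrow> R a b" using \<phi>(2)[of ?e] that by auto
    finally show ?thesis .
  qed
  then show ?thesis using \<phi>(1) by blast
qed

lemma dfn_3D:
  assumes "dfn L M 3 (\<lambda>e. R (e 0) (e 1) (e 2))"
  shows "\<exists>\<phi>\<in>fms L 3. \<forall>a\<in>Dom M. \<forall>b\<in>Dom M. \<forall>c\<in>Dom M.
    holds M \<phi> [a, b, c] \<longleftrightarrow> R a b c"
proof -
  obtain \<phi> where \<phi>: "\<phi> \<in> fms L 3"
    "\<And>e. range e \<subseteq> Dom M \<Longrightarrow> sat M e \<phi> \<longleftrightarrow> R (e 0) (e 1) (e 2)"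
    using assms unfolding dfn_def by blast
  have "holds M \<phi> [a, b, c] \<longleftrightarrow> R a b c" if "a \<in> Dom M" "b \<in> Dom M" "c \<in> Dom M" for a b c
  proof -
    let ?e = "\<lambda>i::nat. if i = 0 then a else if i = 1 then b else c"
    have "holds M \<phi> [a, b, c] \<longleftrightarrow> sat M ?e \<phi>"
      by (rule holds_iff_sat) (use \<phi>(1) in \<open>auto simp: less_Suc_eq numeral_3_eq_3\<close>)
    also have "\<dots> \<longleftrightarrow> R a b c" using \<phi>(2)[of ?e] that by auto
    finally show ?thesis .
  qed
  then show ?thesis using \<phi>(1) by blast
qed

subsection \<open>Saturation\<close>

definition fin_sat :: "('a, 'f, 'r) struct \<Rightarrow> nat \<Rightarrow> ('a, 'f, 'r) pfm set \<Rightarrow> bool" where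
  "fin_sat M n q \<longleftrightarrow>
     (\<forall>F. finite F \<and> F \<subseteq> q \<longrightarrow> (\<exists>xs\<in>tuples (Dom M) n. \<forall>\<chi>\<in>F. pholds M \<chi> xs))"

lemma types_iff:
  "q \<in> types L M n A \<longleftrightarrow> q \<subseteq> pfms L n A \<and> fin_sat M n q \<and>
     (\<forall>\<phi> cs. (\<phi>, cs) \<in> pfms L n A \<longrightarrow> (\<phi>, cs) \<in> q \<or> (Neg \<phi>, cs) \<in> q)"
  by (simp add: types_def fin_sat_def)

text \<open>Zorn's lemma gives a maximal finitely satisfiable extension. It is complete: otherwise
  finite parts refuting \<open>\<phi>\<close> and \<open>Neg \<phi>\<close> would have an
  unsatisfiable union.\<close>

lemma fin_sat_extends:
  assumes "\<Gamma> \<subseteq> pfms L n A" "fin_sat M n \<Gamma>"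
  obtains q where "q \<in> types L M n A" "\<Gamma> \<subseteq> q"
proof -
  let ?S = "{q. \<Gamma> \<subseteq> q \<and> q \<subseteq> pfms L n A \<and> fin_sat M n q}"
  have "\<exists>q\<in>?S. \<forall>q'\<in>?S. q \<subseteq> q' \<longrightarrow> q' = q"
  proof (rule subset_Zorn_nonempty)
    show "?S \<noteq> {}" using assms by auto
    fix C assume C: "C \<noteq> {}" "subset.chain ?S C"
    then have CS: "C \<subseteq> ?S" by (simp add: subset_chain_def)
    have "\<exists>xs\<in>tuples (Dom M) n. \<forall>\<chi>\<in>F. pholds M \<chi> xs" if F: "finite F" "F \<subseteq> \<Union>C" for F
    proof -
      obtain B where B: "B \<in> C" "F \<subseteq> B"
        using finite_subset_Union_chain[OF F C] by blast
      then have "fin_sat M n B" using CS by blast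
      then show ?thesis using B(2) F(1) unfolding fin_sat_def by blast
    qed
    then have "fin_sat M n (\<Union>C)" unfolding fin_sat_def by blast
    moreover have "\<Gamma> \<subseteq> \<Union>C"
    proof -
      obtain B where "B \<in> C" using C(1) by blast
      then show ?thesis using CS by blast
    qed
    moreover have "\<Union>C \<subseteq> pfms L n A" using CS by blast
    ultimately show "\<Union>C \<in> ?S" by simp
  qed
  then obtain q where q0: "q \<in> ?S" "\<forall>q'\<in>?S. q \<subseteq> q' \<longrightarrow> q' = q" by (rule bexE)
  from q0(1) have q: "\<Gamma> \<subseteq> q" "q \<subseteq> pfms L n A" "fin_sat M n q" by simp_all
  have "(\<phi>, cs) \<in> q \<or> (Neg \<phi>, cs) \<in> q" if \<phi>: "(\<phi>, cs) \<in> pfms L n A" for \<phi> cs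
  proof (rule ccontr)
    have ex: "\<exists>F. finite F \<and> F \<subseteq> q \<and>
        (\<forall>xs\<in>tuples (Dom M) n. (\<forall>\<chi>\<in>F. pholds M \<chi> xs) \<longrightarrow> \<not> pholds M \<chi> xs)"
      if "\<chi> \<notin> q" "\<chi> \<in> pfms L n A" for \<chi>
    proof -
      have "\<not> fin_sat M n (insert \<chi> q)"
      proof
        assume "fin_sat M n (insert \<chi> q)"
        then have "insert \<chi> q \<in> ?S" using q that by blast
        then have "insert \<chi> q = q" using q0(2) by blast
        then show False using that by blast
      qed
      then obtain F where F: "finite F" "F \<subseteq> insert \<chi> q"
        "\<forall>xs\<in>tuples (Dom M) n. \<not> (\<forall>\<chi>\<in>F. pholds M \<chi> xs)"
        unfolding fin_sat_def by blast
      then have "finite (F - {\<chi>})" "F - {\<chi>} \<subseteq> q" by auto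
      moreover have "\<not> pholds M \<chi> xs"
        if "xs \<in> tuples (Dom M) n" "\<forall>\<chi>'\<in>F - {\<chi>}. pholds M \<chi>' xs" for xs
        using F(3) that by blast
      ultimately show ?thesis by blast
    qed
    assume "\<not> ((\<phi>, cs) \<in> q \<or> (Neg \<phi>, cs) \<in> q)"
    moreover have "(Neg \<phi>, cs) \<in> pfms L n A" using \<phi> by (simp add: pfms_def Neg_in_fms)
    ultimately obtain F G where F: "finite F" "F \<subseteq> q" "\<forall>xs\<in>tuples (Dom M) n.
        (\<forall>\<chi>\<in>F. pholds M \<chi> xs) \<longrightarrow> \<not> pholds M (\<phi>, cs) xs"
      and G: "finite G" "G \<subseteq> q" "\<forall>xs\<in>tuples (Dom M) n.
        (\<forall>\<chi>\<in>G. pholds M \<chi> xs) \<longrightarrow> \<not> pholds M (Neg \<phi>, cs) xs"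
      using ex[of "(\<phi>, cs)"] ex[of "(Neg \<phi>, cs)"] \<phi> by metis
    have "finite (F \<union> G)" "F \<union> G \<subseteq> q" using F G by auto
    then obtain xs where "xs \<in> tuples (Dom M) n" "\<forall>\<chi>\<in>F \<union> G. pholds M \<chi> xs"
      using q(3) unfolding fin_sat_def by blast
    then show False using F(3) G(3) by (auto simp: pholds_def holds_def)
  qed
  then show thesis using q that unfolding types_iff by blast
qed

text \<open>Saturation in one variable over finite parameter sets is the form in which the monster
  model enters. With the extension lemma above it supplies the compactness arguments.\<close>

locale saturated =
  fixes L :: "('f, 'r) lang" and M :: "('a, 'f, 'r) struct"
  assumes realize_type:
    "\<And>A q. finite A \<Longrightarrow> A \<subseteq> Dom M \<Longrightarrow> q \<in> types L M 1 A \<Longrightarrow> realizations M 1 q \<noteq> {}"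
begin

text \<open>Also used contrapositively: conditions without a common realization have a finite subset
  without one, and finitely many conditions fit into one formula.\<close>

lemma realize_partial_type:
  assumes "finite A" "A \<subseteq> Dom M" "\<Gamma> \<subseteq> pfms L 1 A"
    "\<And>F. finite F \<Longrightarrow> F \<subseteq> \<Gamma> \<Longrightarrow> \<exists>b\<in>Dom M. \<forall>\<chi>\<in>F. pholds M \<chi> [b]"
  shows "\<exists>b\<in>Dom M. \<forall>\<chi>\<in>\<Gamma>. pholds M \<chi> [b]"
proof -
  have "fin_sat M 1 \<Gamma>" unfolding fin_sat_def
  proof (intro allI impI)
    fix F assume "finite F \<and> F \<subseteq> \<Gamma>"
    then obtain b where "b \<in> Dom M" "\<forall>\<chi>\<in>F. pholds M \<chi> [b]" using assms(4) by blast
    then show "\<exists>xs\<in>tuples (Dom M) 1. \<forall>\<chi>\<in>F. pholds M \<chi> xs"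
      by (intro bexI[of _ "[b]"]) (simp_all add: tuples_def)
  qed
  with assms(3) obtain q where q: "q \<in> types L M 1 A" "\<Gamma> \<subseteq> q" by (rule fin_sat_extends)
  then have "realizations M 1 q \<noteq> {}" using assms(1,2) by (intro realize_type)
  then obtain xs where xs: "xs \<in> tuples (Dom M) 1" "\<forall>\<chi>\<in>q. pholds M \<chi> xs"
    unfolding realizations_def by blast
  then obtain b where "b \<in> Dom M" "xs = [b]" using tuples_1[of xs "Dom M"] by blast
  then show ?thesis using q(2) xs(2) by blast
qed

text \<open>The coordinates are realized one after the other: first \<open>a\<close> for the part of
  \<open>q\<close> in the first variable, then \<open>b\<close> for \<open>q(a, y)\<close>, which is
  finitely satisfiable because the existential statements needed belong to \<open>q\<close>.\<close>

lemma realize_2_type: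
  assumes q: "q \<in> types L M 2 {}"
  obtains a b where "[a, b] \<in> realizations M 2 q"
proof -
  have q': "q \<subseteq> pfms L 2 {}" "fin_sat M 2 q" using q unfolding types_iff by blast+
  have complete: "(\<phi>, []) \<in> q \<or> (Neg \<phi>, []) \<in> q" if "\<phi> \<in> fms L 2" for \<phi>
    using q pfms_emptyI[OF that] unfolding types_iff by blast
  have fs: "\<exists>a\<in>Dom M. \<exists>b\<in>Dom M. \<forall>\<chi>\<in>F. pholds M \<chi> [a, b]" if "finite F" "F \<subseteq> q" for F
  proof -
    obtain xs where xs: "xs \<in> tuples (Dom M) 2" "\<forall>\<chi>\<in>F. pholds M \<chi> xs"
      using q'(2) \<open>finite F\<close> \<open>F \<subseteq> q\<close> unfolding fin_sat_def by blast
    then obtain a b where "a \<in> Dom M" "b \<in> Dom M" "xs = [a, b]"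
      using tuples_2[of xs "Dom M"] by blast
    then show ?thesis using xs(2) by blast
  qed
  have restrict: "holds M \<phi> [a, b] \<longleftrightarrow> holds M \<phi> [a]" if "\<phi> \<in> fms L 1" for \<phi> a b
    unfolding holds_def by (rule sat_cong) (use that in \<open>auto simp: fms_def\<close>)
  have "\<exists>a\<in>Dom M. \<forall>\<chi>\<in>q \<inter> pfms L 1 {}. pholds M \<chi> [a]"
  proof (rule realize_partial_type[of "{}" "q \<inter> pfms L 1 {}"])
    fix F assume F: "finite F" "F \<subseteq> q \<inter> pfms L 1 {}"
    then obtain a b where ab: "a \<in> Dom M" "\<forall>\<chi>\<in>F. pholds M \<chi> [a, b]" using fs[of F] by blast
    have "pholds M \<chi> [a]" if \<chi>: "\<chi> \<in> F" for \<chi>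
    proof -
      have "\<chi> \<in> pfms L 1 {}" using F(2) \<chi> by blast
      then obtain \<phi> where "\<phi> \<in> fms L 1" "\<chi> = (\<phi>, [])" by (rule pfms_emptyE)
      then show ?thesis using ab(2) \<chi> restrict[of \<phi> a b] by (force simp: pholds_def)
    qed
    then show "\<exists>a\<in>Dom M. \<forall>\<chi>\<in>F. pholds M \<chi> [a]" using ab(1) by blast
  qed auto
  then obtain a where a: "a \<in> Dom M" "\<forall>\<chi>\<in>q \<inter> pfms L 1 {}. pholds M \<chi> [a]" by (rule bexE)
  let ?\<Gamma> = "(\<lambda>\<phi>. (\<phi>, [a])) ` {\<phi>. (\<phi>, []) \<in> q}"
  have "\<exists>b\<in>Dom M. \<forall>\<chi>\<in>?\<Gamma>. pholds M \<chi> [b]"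
  proof (rule realize_partial_type[of "{a}" ?\<Gamma>])
    have "(\<phi>, [a]) \<in> pfms L 1 {a}" if "(\<phi>, []) \<in> q" for \<phi>
    proof -
      have "(\<phi>, [] :: 'a list) \<in> pfms L 2 {}" using q'(1) that by blast
      then show ?thesis by (simp add: pfms_def numeral_2_eq_2)
    qed
    then show "?\<Gamma> \<subseteq> pfms L 1 {a}" by blast
    fix F assume F: "finite F" "F \<subseteq> ?\<Gamma>"
    obtain G where G: "finite G" "G \<subseteq> {\<phi>. (\<phi>, []) \<in> q}" "F = (\<lambda>\<phi>. (\<phi>, [a])) ` G"
      using finite_subset_image[OF F] by (elim exE conjE)
    have G2: "\<phi> \<in> fms L 2" if "\<phi> \<in> G" for \<phi>
    proof -
      have "(\<phi>, [] :: 'a list) \<in> pfms L 2 {}" using G(2) q'(1) that by blast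
      then show ?thesis by (simp add: pfms_def numeral_2_eq_2)
    qed
    have "dfn L M 1 (\<lambda>e. \<exists>b\<in>Dom M. \<forall>\<phi>\<in>G. holds M \<phi> [e 0, b])"
      by (intro dfn_Bex dfn_Ball_finite dfn_holds2) (auto simp: G(1) G2)
    from dfn_1D[of L M "\<lambda>a. \<exists>b\<in>Dom M. \<forall>\<phi>\<in>G. holds M \<phi> [a, b]", OF this]
    obtain \<theta> where \<theta>: "\<theta> \<in> fms L 1"
      "\<forall>a\<in>Dom M. holds M \<theta> [a] \<longleftrightarrow> (\<exists>b\<in>Dom M. \<forall>\<phi>\<in>G. holds M \<phi> [a, b])"
      by (rule bexE)
    \<comment> \<open>Otherwise \<open>Neg \<theta>\<close> and the formulas of \<open>G\<close>
      would be realized together by some \<open>(u, v)\<close>, and \<open>v\<close> would witness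
      \<open>\<theta>\<close> at \<open>u\<close>.\<close>
    have "(\<theta>, []) \<in> q"
    proof (rule ccontr)
      assume "(\<theta>, []) \<notin> q"
      moreover have "\<theta> \<in> fms L 2" by (rule fms_mono[OF _ \<theta>(1)]) simp
      ultimately have "(Neg \<theta>, []) \<in> q" using complete by blast
      moreover have "(\<lambda>\<phi>. (\<phi>, [])) ` G \<subseteq> q" using G(2) by blast
      ultimately obtain u v where uv: "u \<in> Dom M" "v \<in> Dom M"
        "\<forall>\<chi>\<in>insert (Neg \<theta>, []) ((\<lambda>\<phi>. (\<phi>, [])) ` G). pholds M \<chi> [u, v]"
        using fs[of "insert (Neg \<theta>, []) ((\<lambda>\<phi>. (\<phi>, [])) ` G)"] G(1) by blast
      then have "\<not> holds M \<theta> [u, v]" "\<forall>\<phi>\<in>G. holds M \<phi> [u, v]"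
        by (simp_all add: pholds_def holds_def)
      then show False using \<theta> restrict[of \<theta>] uv(1,2) by blast
    qed
    then have "pholds M (\<theta>, []) [a]" using a(2) pfms_emptyI[OF \<theta>(1)] by blast
    then have "\<exists>b\<in>Dom M. \<forall>\<phi>\<in>G. holds M \<phi> [a, b]"
      using \<theta>(2) a(1) by (simp add: pholds_def)
    then show "\<exists>b\<in>Dom M. \<forall>\<chi>\<in>F. pholds M \<chi> [b]" by (simp add: G(3) pholds_def)
  qed (use a(1) in auto)
  then obtain b where b: "b \<in> Dom M" "\<forall>\<chi>\<in>?\<Gamma>. pholds M \<chi> [b]" by (rule bexE)
  have "pholds M \<chi> [a, b]" if \<chi>: "\<chi> \<in> q" for \<chi>
  proof -
    have "\<chi> \<in> pfms L 2 {}" using \<chi> q'(1) by blast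
    then obtain \<phi> where "\<chi> = (\<phi>, [])" by (rule pfms_emptyE)
    moreover from this have "pholds M (\<phi>, [a]) [b]" using b(2) \<chi> by blast
    ultimately show ?thesis by (simp add: pholds_def)
  qed
  then have "[a, b] \<in> realizations M 2 q"
    unfolding realizations_def using a(1) b(1) by (simp add: tuples_2)
  then show thesis by (rule that)
qed

end

section \<open>Realizations of a complete 1-type\<close>

locale type_in_saturated = saturated L M
  for L :: "('f, 'r) lang" and M :: "('a, 'f, 'r) struct" +
  fixes p :: "('a, 'f, 'r) pfm set"
  assumes p_type: "p \<in> types L M 1 {}"
begin

abbreviation "P \<equiv> real1 M p"

lemma p_memE:
  assumes "\<chi> \<in> p"
  obtains \<pi> where "\<pi> \<in> fms L 1" "\<chi> = (\<pi>, [])"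
proof -
  have "\<chi> \<in> pfms L 1 {}" using assms p_type unfolding types_iff by blast
  then show thesis by (rule pfms_emptyE) (rule that)
qed

lemma p_pfms:
  assumes "\<chi> \<in> p"
  shows "\<chi> \<in> pfms L 1 A"
proof -
  obtain \<pi> where "\<pi> \<in> fms L 1" "\<chi> = (\<pi>, [])" using assms by (rule p_memE)
  then show ?thesis by (simp add: pfms_def)
qed

lemma P_iff: "c \<in> P \<longleftrightarrow> c \<in> Dom M \<and> (\<forall>\<chi>\<in>p. pholds M \<chi> [c])"
  by (simp add: real1_def realizations_def tuples_def)

lemma P_Dom: "c \<in> P \<Longrightarrow> c \<in> Dom M"
  by (simp add: P_iff)

lemma P_nonempty: "P \<noteq> {}"
proof -
  have "\<exists>b\<in>Dom M. \<forall>\<chi>\<in>p. pholds M \<chi> [b]"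
  proof (rule realize_partial_type[of "{}" p])
    show "p \<subseteq> pfms L 1 {}" using p_type unfolding types_iff by blast
    fix F assume F: "finite F" "F \<subseteq> p"
    have "fin_sat M 1 p" using p_type unfolding types_iff by blast
    then obtain xs where xs: "xs \<in> tuples (Dom M) 1" "\<forall>\<chi>\<in>F. pholds M \<chi> xs"
      using F unfolding fin_sat_def by blast
    then obtain b where "b \<in> Dom M" "xs = [b]" using tuples_1[of xs "Dom M"] by blast
    then show "\<exists>b\<in>Dom M. \<forall>\<chi>\<in>F. pholds M \<chi> [b]" using xs(2) by blast
  qed auto
  then show ?thesis using P_iff by blast
qed

lemma P_mem_p:
  assumes "a \<in> P" "\<pi> \<in> fms L 1" "holds M \<pi> [a]"
  shows "(\<pi>, []) \<in> p"
proof (rule ccontr)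
  assume "(\<pi>, []) \<notin> p"
  then have "(Neg \<pi>, []) \<in> p" using p_type pfms_emptyI[OF assms(2)] unfolding types_iff by blast
  then have "pholds M (Neg \<pi>, []) [a]" using assms(1) P_iff by blast
  then show False using assms(3) by (simp add: pholds_def holds_def)
qed

text \<open>Completeness of \<open>p\<close> decides every parameter-free definable property, so all
  realizations agree on it. This does the work usually given to automorphisms.\<close>

lemma transfer_P:
  assumes "dfn L M 1 (\<lambda>e. R (e 0))" "a \<in> P" "b \<in> P" "R a"
  shows "R b"
proof -
  from dfn_1D[OF assms(1)] obtain \<pi> where \<pi>: "\<pi> \<in> fms L 1" "\<forall>a\<in>Dom M. holds M \<pi> [a] \<longleftrightarrow> R a"
    by (rule bexE)
  then have "holds M \<pi> [a]" using assms(2,4) P_Dom by blast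
  then have "(\<pi>, []) \<in> p" using P_mem_p assms(2) \<pi>(1) by blast
  then have "pholds M (\<pi>, []) [b]" using assms(3) P_iff by blast
  then have "holds M \<pi> [b]" by (simp add: pholds_def)
  then show ?thesis using \<pi>(2) assms(3) P_Dom by blast
qed

lemma tp_realization:
  assumes "b \<in> P"
  shows "tp L M [b] {} = p"
proof (rule set_eqI)
  fix \<chi>
  show "\<chi> \<in> tp L M [b] {} \<longleftrightarrow> \<chi> \<in> p"
  proof
    assume "\<chi> \<in> tp L M [b] {}"
    then have \<chi>: "\<chi> \<in> pfms L 1 {}" "pholds M \<chi> [b]" by (simp_all add: tp_def)
    from \<chi>(1) obtain \<pi> where "\<pi> \<in> fms L 1" "\<chi> = (\<pi>, [])" by (rule pfms_emptyE)
    then show "\<chi> \<in> p" using P_mem_p[OF assms] \<chi>(2) by (simp add: pholds_def)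
  next
    assume \<chi>: "\<chi> \<in> p"
    then obtain \<pi> where "\<pi> \<in> fms L 1" "\<chi> = (\<pi>, [])" by (rule p_memE)
    then have "\<chi> \<in> pfms L 1 {}" by (simp add: pfms_emptyI)
    moreover have "pholds M \<chi> [b]" using \<chi> assms P_iff by blast
    ultimately show "\<chi> \<in> tp L M [b] {}" by (simp add: tp_def)
  qed
qed

subsection \<open>Semi-isolation and principal formulas on the realizations of a type\<close>

text \<open>For \<open>b\<close> in \<open>P\<close> this is the clause
  \<open>\<psi>(a, y) \<turnstile> tp(b)\<close> of semi-isolation; \<open>b\<close> disappears
  because \<open>tp(b)\<close> is \<open>p\<close>.\<close>

definition into_P :: "('f, 'r) fm \<Rightarrow> 'a \<Rightarrow> bool" where
  "into_P \<psi> a \<longleftrightarrow> (\<forall>c\<in>Dom M. holds M \<psi> [a, c] \<longrightarrow> c \<in> P)"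

lemma arrow_iff:
  assumes "b \<in> P"
  shows "arrow L M a b \<longleftrightarrow> (\<exists>\<psi>\<in>fms L 2. holds M \<psi> [a, b] \<and> into_P \<psi> a)"
  by (simp add: arrow_def semi_isol_def into_P_def tp_realization[OF assms])

text \<open>Containment in \<open>P\<close> is an infinite conjunction, but for each formula of
  \<open>p\<close> separately it is a definable condition on \<open>a\<close> and transfers.\<close>

lemma into_P_transfer:
  assumes "\<psi> \<in> fms L 2" "a \<in> P" "b \<in> P" "into_P \<psi> a"
  shows "into_P \<psi> b"
  unfolding into_P_def
proof (intro ballI impI)
  fix c assume c: "c \<in> Dom M" "holds M \<psi> [b, c]"
  have "pholds M \<chi> [c]" if \<chi>: "\<chi> \<in> p" for \<chi>
  proof -
    obtain \<pi> where \<pi>: "\<pi> \<in> fms L 1" "\<chi> = (\<pi>, [])" using \<chi> by (rule p_memE)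
    have "dfn L M 1 (\<lambda>e. \<forall>c\<in>Dom M. holds M \<psi> [e 0, c] \<longrightarrow> holds M \<pi> [c])"
      by (intro dfn_Ball dfn_imp dfn_holds2 dfn_holds1 assms(1) \<pi>(1)) simp_all
    moreover have "\<forall>c\<in>Dom M. holds M \<psi> [a, c] \<longrightarrow> holds M \<pi> [c]"
    proof (intro ballI impI)
      fix c assume "c \<in> Dom M" "holds M \<psi> [a, c]"
      then have "c \<in> P" using assms(4) unfolding into_P_def by blast
      then have "pholds M \<chi> [c]" using \<chi> P_iff by blast
      then show "holds M \<pi> [c]" by (simp add: \<pi>(2) pholds_def)
    qed
    ultimately have "\<forall>c\<in>Dom M. holds M \<psi> [b, c] \<longrightarrow> holds M \<pi> [c]"
      using assms(2,3)
        transfer_P[of "\<lambda>a. \<forall>c\<in>Dom M. holds M \<psi> [a, c] \<longrightarrow> holds M \<pi> [c]" a b] by simp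
    then show ?thesis using c by (simp add: \<pi>(2) pholds_def)
  qed
  then show "c \<in> P" using c(1) P_iff by blast
qed

lemma arrow_refl:
  assumes "a \<in> P"
  shows "arrow L M a a"
proof -
  let ?\<psi> = "Eq (Var 0) (Var 1) :: ('f, 'r) fm"
  have holds_eq: "holds M ?\<psi> [a, b] \<longleftrightarrow> a = b" for b by (simp add: holds_def)
  have "?\<psi> \<in> fms L 2" by (simp add: fms_def)
  moreover have "holds M ?\<psi> [a, a]" by (simp only: holds_eq)
  moreover have "into_P ?\<psi> a" using assms unfolding into_P_def holds_eq by simp
  ultimately show ?thesis unfolding arrow_iff[OF assms] by blast
qed

text \<open>The composite formula asks for an intermediate \<open>z\<close>. Any such
  \<open>z\<close> lies in \<open>P\<close>, so the property of \<open>\<psi>2\<close> at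
  \<open>b\<close> is available at \<open>z\<close>.\<close>

lemma arrow_trans:
  assumes "a \<in> P" "b \<in> P" "c \<in> P" "arrow L M a b" "arrow L M b c"
  shows "arrow L M a c"
proof -
  obtain \<psi>1 where \<psi>1: "\<psi>1 \<in> fms L 2" "holds M \<psi>1 [a, b]" "into_P \<psi>1 a"
    using assms(4) arrow_iff[OF assms(2)] by blast
  obtain \<psi>2 where \<psi>2: "\<psi>2 \<in> fms L 2" "holds M \<psi>2 [b, c]" "into_P \<psi>2 b"
    using assms(5) arrow_iff[OF assms(3)] by blast
  let ?R = "\<lambda>x y. \<exists>z\<in>Dom M. holds M \<psi>1 [x, z] \<and> holds M \<psi>2 [z, y]"
  have "dfn L M 2 (\<lambda>e. ?R (e 0) (e 1))"
    by (intro dfn_Bex dfn_and dfn_holds2 \<psi>1(1) \<psi>2(1)) simp_all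
  from dfn_2D[of L M ?R, OF this] obtain \<psi>
    where \<psi>: "\<psi> \<in> fms L 2" "\<forall>a\<in>Dom M. \<forall>b\<in>Dom M. holds M \<psi> [a, b] \<longleftrightarrow> ?R a b"
    by (rule bexE)
  have D: "a \<in> Dom M" "b \<in> Dom M" "c \<in> Dom M" using assms P_Dom by blast+
  have "into_P \<psi> a" unfolding into_P_def
  proof (intro ballI impI)
    fix y assume y: "y \<in> Dom M" "holds M \<psi> [a, y]"
    then obtain z where z: "z \<in> Dom M" "holds M \<psi>1 [a, z]" "holds M \<psi>2 [z, y]"
      using \<psi>(2) D by blast
    then have "z \<in> P" using \<psi>1(3) unfolding into_P_def by blast
    then have "into_P \<psi>2 z" using into_P_transfer \<psi>2 assms(2) by blast
    then show "y \<in> P" using z(3) y(1) unfolding into_P_def by blast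
  qed
  moreover have "holds M \<psi> [a, c]" using \<psi>(2) D \<psi>1(2) \<psi>2(2) by blast
  ultimately show ?thesis using arrow_iff[OF assms(3)] \<psi>(1) by blast
qed

text \<open>At one \<open>d0\<close> the formula isolates a complete type over \<open>d0\<close>,
  which decides \<open>\<theta>(d0, y)\<close>. Either outcome is a definable condition on
  \<open>d0\<close> and transfers, so the same alternative holds at every \<open>d\<close>.\<close>

lemma principal_decides:
  assumes "principal L M p \<psi>" "\<theta> \<in> fms L 2"
  shows "(\<forall>d\<in>P. \<forall>a\<in>Dom M. holds M \<psi> [d, a] \<longrightarrow> holds M \<theta> [d, a]) \<or>
    (\<forall>d\<in>P. \<forall>a\<in>Dom M. holds M \<psi> [d, a] \<longrightarrow> \<not> holds M \<theta> [d, a])"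
proof -
  have \<psi>: "\<psi> \<in> fms L 2" using assms(1) by (simp add: principal_def)
  obtain d0 q where d0: "d0 \<in> P" "q \<in> types L M 1 {d0}" "isolates M 1 (\<psi>, [d0]) q"
    using assms(1) unfolding principal_def by blast
  have iso: "pholds M \<chi> [a]" if "a \<in> Dom M" "holds M \<psi> [d0, a]" "\<chi> \<in> q" for a \<chi>
  proof -
    have "[a] \<in> tuples (Dom M) 1" "pholds M (\<psi>, [d0]) [a]"
      using that by (simp_all add: tuples_def pholds_def)
    then have "[a] \<in> realizations M 1 q" using d0(3) unfolding isolates_def by blast
    then show ?thesis using that(3) unfolding realizations_def by blast
  qed
  have "(\<theta>, [d0]) \<in> pfms L 1 {d0}" using assms(2) by (simp add: pfms_def numeral_2_eq_2)
  then consider "(\<theta>, [d0]) \<in> q" | "(Neg \<theta>, [d0]) \<in> q"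
    using d0(2) unfolding types_iff by blast
  then show ?thesis
  proof cases
    case 1
    have "dfn L M 1 (\<lambda>e. \<forall>a\<in>Dom M. holds M \<psi> [e 0, a] \<longrightarrow> holds M \<theta> [e 0, a])"
      by (intro dfn_Ball dfn_imp dfn_holds2 \<psi> assms(2)) simp_all
    moreover have "\<forall>a\<in>Dom M. holds M \<psi> [d0, a] \<longrightarrow> holds M \<theta> [d0, a]"
      using iso[OF _ _ 1] by (simp add: pholds_def)
    ultimately show ?thesis using d0(1)
        transfer_P[of "\<lambda>d. \<forall>a\<in>Dom M. holds M \<psi> [d, a] \<longrightarrow> holds M \<theta> [d, a]"] by blast
  next
    case 2
    have "dfn L M 1 (\<lambda>e. \<forall>a\<in>Dom M. holds M \<psi> [e 0, a] \<longrightarrow> \<not> holds M \<theta> [e 0, a])"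
      by (intro dfn_Ball dfn_imp dfn_not dfn_holds2 \<psi> assms(2)) simp_all
    moreover have "\<forall>a\<in>Dom M. holds M \<psi> [d0, a] \<longrightarrow> \<not> holds M \<theta> [d0, a]"
      using iso[OF _ _ 2] by (simp add: pholds_def holds_def)
    ultimately show ?thesis using d0(1)
        transfer_P[of "\<lambda>d. \<forall>a\<in>Dom M. holds M \<psi> [d, a] \<longrightarrow> \<not> holds M \<theta> [d, a]"] by blast
  qed
qed

lemma principal_strict:
  assumes "principal L M p \<psi>"
  obtains a b where "a \<in> P" "b \<in> Dom M" "holds M \<psi> [a, b]" "into_P \<psi> a" "\<not> arrow L M b a"
proof -
  obtain a q where a: "a \<in> P" "p \<subseteq> q" "isolates M 1 (\<psi>, [a]) q"
    "\<forall>b\<in>Dom M. holds M \<psi> [a, b] \<longrightarrow> strict_arrow L M \<psi> a b"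
    using assms unfolding principal_def by blast
  obtain xs where xs: "xs \<in> tuples (Dom M) 1" "pholds M (\<psi>, [a]) xs"
    using a(3) unfolding isolates_def by blast
  then obtain b where b: "b \<in> Dom M" "xs = [b]" using tuples_1[of xs "Dom M"] by blast
  then have "holds M \<psi> [a, b]" using xs(2) by (simp add: pholds_def)
  moreover have "c \<in> P" if "c \<in> Dom M" "holds M \<psi> [a, c]" for c
  proof -
    have "[c] \<in> tuples (Dom M) 1" "pholds M (\<psi>, [a]) [c]"
      using that by (simp_all add: tuples_def pholds_def)
    then have "[c] \<in> realizations M 1 q" using a(3) unfolding isolates_def by blast
    then show ?thesis using a(2) that(1) unfolding P_iff realizations_def by blast
  qed
  ultimately show thesis
    using a(1,4) b(1) that unfolding into_P_def strict_arrow_def by blast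
qed

lemma principal_into_P:
  assumes "principal L M p \<psi>" "d \<in> P"
  shows "into_P \<psi> d"
proof -
  have "\<psi> \<in> fms L 2" using assms(1) by (simp add: principal_def)
  then show ?thesis using principal_strict[OF assms(1)] into_P_transfer assms(2) by metis
qed

lemma principal_arrow:
  assumes "principal L M p \<psi>" "d \<in> P" "a \<in> P" "holds M \<psi> [d, a]"
  shows "arrow L M d a"
  using principal_into_P[OF assms(1,2)] assms(1,4) arrow_iff[OF assms(3)]
  unfolding principal_def by blast

text \<open>Strictness is given at one realization only. A formula semi-isolating \<open>d\<close>
  over \<open>a\<close> would, by \<open>principal_decides\<close>, also hold at the reference pair
  and give the forbidden arrow there.\<close>

lemma principal_not_arrow:
  assumes "principal L M p \<psi>" "d \<in> P" "a \<in> P" "holds M \<psi> [d, a]"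
  shows "\<not> arrow L M a d"
proof
  assume "arrow L M a d"
  then obtain \<theta> where \<theta>: "\<theta> \<in> fms L 2" "holds M \<theta> [a, d]" "into_P \<theta> a"
    using arrow_iff[OF assms(2)] by blast
  obtain d0 a0 where d0: "d0 \<in> P" "a0 \<in> Dom M" "holds M \<psi> [d0, a0]" "into_P \<psi> d0"
    "\<not> arrow L M a0 d0"
    using assms(1) by (rule principal_strict)
  have a0: "a0 \<in> P" using d0 unfolding into_P_def by blast
  \<comment> \<open>\<open>principal_decides\<close> expects the predecessor in the first variable,
    so the variables of \<open>\<theta>\<close> are exchanged.\<close>
  have "dfn L M 2 (\<lambda>e. holds M \<theta> [e 1, e 0])" by (intro dfn_holds2 \<theta>(1)) simp_all
  from dfn_2D[of L M "\<lambda>x y. holds M \<theta> [y, x]", OF this] obtain \<theta>'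
    where \<theta>': "\<theta>' \<in> fms L 2" "\<forall>x\<in>Dom M. \<forall>y\<in>Dom M. holds M \<theta>' [x, y] \<longleftrightarrow> holds M \<theta> [y, x]"
    by (rule bexE)
  have "holds M \<theta>' [d0, a0]"
    using principal_decides[OF assms(1) \<theta>'(1)] \<theta>'(2) \<theta>(2) assms(2-4) d0 P_Dom by blast
  then have "holds M \<theta> [a0, d0]" using \<theta>'(2) d0(1,2) P_Dom by blast
  moreover have "into_P \<theta> a0" using into_P_transfer[OF \<theta>(1) assms(3) a0 \<theta>(3)] .
  ultimately show False using d0(5) arrow_iff[OF d0(1)] \<theta>(1) by blast
qed

text \<open>This is the closedness of \<open>C\<^sub>i\<^sub>j\<close>: if no realization of
  \<open>p\<close> is a common predecessor of \<open>a\<close> and \<open>b\<close>, compactness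
  shows that already a finite part of \<open>p\<close> rules one out, and that is expressible by a
  formula.\<close>

lemma co_predecessor_closed:
  assumes \<psi>: "\<psi>1 \<in> fms L 2" "\<psi>2 \<in> fms L 2" and ab: "a \<in> Dom M" "b \<in> Dom M"
    and none: "\<not> (\<exists>d\<in>P. holds M \<psi>1 [d, a] \<and> holds M \<psi>2 [d, b])"
  shows "\<exists>\<theta>\<in>fms L 2. holds M \<theta> [a, b] \<and> (\<forall>a'\<in>Dom M. \<forall>b'\<in>Dom M. holds M \<theta> [a', b'] \<longrightarrow>
    \<not> (\<exists>d\<in>P. holds M \<psi>1 [d, a'] \<and> holds M \<psi>2 [d, b']))"
proof -
  \<comment> \<open>In \<open>pfms\<close> parameters fill the first variables, while
    \<open>a\<close> and \<open>b\<close> sit in the second variable of \<open>\<psi>1\<close> and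
    \<open>\<psi>2\<close>.\<close>
  have swap: "\<exists>\<psi>'\<in>fms L 2. \<forall>x\<in>Dom M. \<forall>y\<in>Dom M. holds M \<psi>' [x, y] \<longleftrightarrow> holds M \<psi> [y, x]"
    if "\<psi> \<in> fms L 2" for \<psi>
  proof -
    have "dfn L M 2 (\<lambda>e. holds M \<psi> [e 1, e 0])" by (intro dfn_holds2 that) simp_all
    then show ?thesis by (rule dfn_2D[of L M "\<lambda>x y. holds M \<psi> [y, x]"])
  qed
  from swap[OF \<psi>(1)] obtain \<chi>1 where \<chi>1: "\<chi>1 \<in> fms L 2"
    "\<forall>x\<in>Dom M. \<forall>y\<in>Dom M. holds M \<chi>1 [x, y] \<longleftrightarrow> holds M \<psi>1 [y, x]" by (rule bexE)
  from swap[OF \<psi>(2)] obtain \<chi>2 where \<chi>2: "\<chi>2 \<in> fms L 2"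
    "\<forall>x\<in>Dom M. \<forall>y\<in>Dom M. holds M \<chi>2 [x, y] \<longleftrightarrow> holds M \<psi>2 [y, x]" by (rule bexE)
  let ?\<Gamma> = "p \<union> {(\<chi>1, [a]), (\<chi>2, [b])}"
  have sub: "?\<Gamma> \<subseteq> pfms L 1 {a, b}"
  proof -
    have "(\<chi>1, [a]) \<in> pfms L 1 {a, b}" "(\<chi>2, [b]) \<in> pfms L 1 {a, b}"
      using \<chi>1(1) \<chi>2(1) by (simp_all add: pfms_def numeral_2_eq_2)
    then show ?thesis using p_pfms by blast
  qed
  have "\<not> (\<exists>c\<in>Dom M. \<forall>\<chi>\<in>?\<Gamma>. pholds M \<chi> [c])"
  proof
    assume "\<exists>c\<in>Dom M. \<forall>\<chi>\<in>?\<Gamma>. pholds M \<chi> [c]"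
    then obtain c where c: "c \<in> Dom M" "\<forall>\<chi>\<in>?\<Gamma>. pholds M \<chi> [c]" by (rule bexE)
    then have "c \<in> P" using P_iff by blast
    moreover have "holds M \<chi>1 [a, c]" "holds M \<chi>2 [b, c]"
      using c(2) by (simp_all add: pholds_def)
    ultimately show False using none \<chi>1(2) \<chi>2(2) ab c(1) by blast
  qed
  then obtain F where F: "finite F" "F \<subseteq> ?\<Gamma>" "\<not> (\<exists>c\<in>Dom M. \<forall>\<chi>\<in>F. pholds M \<chi> [c])"
    using realize_partial_type[of "{a, b}" ?\<Gamma>] sub ab by blast
  \<comment> \<open>\<open>?R\<close> below forbids common predecessors among all elements
    satisfying the finite set \<open>G\<close>; every realization of \<open>p\<close> is among
    these.\<close>
  define G where "G = {\<pi>. (\<pi>, []) \<in> F \<inter> p}"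
  have "finite G" unfolding G_def by (rule finite_surj[OF F(1), of _ fst]) force
  have G: "\<pi> \<in> fms L 1" if "\<pi> \<in> G" for \<pi>
    using p_memE[of "(\<pi>, [])"] that unfolding G_def by blast
  let ?R = "\<lambda>x y. \<not> (\<exists>c\<in>Dom M. (\<forall>\<pi>\<in>G. holds M \<pi> [c]) \<and> holds M \<psi>1 [c, x] \<and> holds M \<psi>2 [c, y])"
  have "dfn L M 2 (\<lambda>e. ?R (e 0) (e 1))"
    by (intro dfn_not dfn_Bex dfn_and dfn_Ball_finite dfn_holds1 dfn_holds2 \<psi> \<open>finite G\<close> G)
      simp_all
  from dfn_2D[of L M ?R, OF this] obtain \<theta>
    where \<theta>: "\<theta> \<in> fms L 2" "\<forall>a\<in>Dom M. \<forall>b\<in>Dom M. holds M \<theta> [a, b] \<longleftrightarrow> ?R a b"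
    by (rule bexE)
  have "?R a b"
  proof
    assume "\<exists>c\<in>Dom M. (\<forall>\<pi>\<in>G. holds M \<pi> [c]) \<and> holds M \<psi>1 [c, a] \<and> holds M \<psi>2 [c, b]"
    then obtain c where c: "c \<in> Dom M" "\<forall>\<pi>\<in>G. holds M \<pi> [c]" "holds M \<psi>1 [c, a]"
      "holds M \<psi>2 [c, b]" by blast
    have "pholds M \<chi> [c]" if \<chi>: "\<chi> \<in> F" for \<chi>
    proof (cases "\<chi> \<in> p")
      case True
      then obtain \<pi> where "\<pi> \<in> fms L 1" "\<chi> = (\<pi>, [])" by (rule p_memE)
      then show ?thesis using c(2) \<chi> True by (simp add: G_def pholds_def)
    next
      case False
      then have "\<chi> = (\<chi>1, [a]) \<or> \<chi> = (\<chi>2, [b])" using \<chi> F(2) by blast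
      moreover have "pholds M (\<chi>1, [a]) [c]" using c \<chi>1(2) ab by (simp add: pholds_def)
      moreover have "pholds M (\<chi>2, [b]) [c]" using c \<chi>2(2) ab by (simp add: pholds_def)
      ultimately show ?thesis by blast
    qed
    then show False using F(3) c(1) by blast
  qed
  then have "holds M \<theta> [a, b]" using \<theta>(2) ab by blast
  moreover have "\<not> (\<exists>d\<in>P. holds M \<psi>1 [d, a'] \<and> holds M \<psi>2 [d, b'])"
    if "a' \<in> Dom M" "b' \<in> Dom M" "holds M \<theta> [a', b']" for a' b'
  proof
    assume "\<exists>d\<in>P. holds M \<psi>1 [d, a'] \<and> holds M \<psi>2 [d, b']"
    then obtain d where d: "d \<in> P" "holds M \<psi>1 [d, a']" "holds M \<psi>2 [d, b']" by blast
    have "holds M \<pi> [d]" if "\<pi> \<in> G" for \<pi>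
    proof -
      have "(\<pi>, []) \<in> p" using that by (simp add: G_def)
      then have "pholds M (\<pi>, []) [d]" using d(1) P_iff by blast
      then show ?thesis by (simp add: pholds_def)
    qed
    moreover have "?R a' b'" using \<theta>(2) that by blast
    ultimately show False using d P_Dom by blast
  qed
  ultimately show ?thesis using \<theta>(1) by blast
qed

definition same_type :: "'a \<Rightarrow> 'a \<Rightarrow> 'a \<Rightarrow> 'a \<Rightarrow> bool" where
  "same_type a b a' b' \<longleftrightarrow> (\<forall>\<theta>\<in>fms L 2. holds M \<theta> [a, b] \<longleftrightarrow> holds M \<theta> [a', b'])"

subsection \<open>The strict order property from finitely many types of pairs\<close>

text \<open>If all types of pairs are isolated, then by compactness there are only finitely many, so
  that semi-isolation on \<open>P\<close> is uniformly definable with all its sections inside \<open>P\<close>. The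
  sections along an infinite strict chain of this quasi-order are then strictly increasing.\<close>

lemma SOP_if_pairs_isolated:
  assumes iso: "\<And>a b. a \<in> P \<Longrightarrow> b \<in> P \<Longrightarrow> \<exists>\<theta>\<in>fms L 2. holds M \<theta> [a, b] \<and>
      (\<forall>a'\<in>P. \<forall>b'\<in>P. holds M \<theta> [a', b'] \<longrightarrow> same_type a b a' b')"
    and pred: "\<And>a. a \<in> P \<Longrightarrow> \<exists>d\<in>P. arrow L M d a \<and> \<not> arrow L M a d"
  shows "SOP L M"
proof -
  obtain a where a: "a \<in> P" using P_nonempty by blast
  have aD: "a \<in> Dom M" using a P_Dom by blast
  \<comment> \<open>\<open>A\<close> collects the formulas witnessing arrows from \<open>a\<close>
    into \<open>P\<close>, and \<open>B\<close> those that fail at every successor of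
    \<open>a\<close> in \<open>P\<close>. Thus \<open>?\<Gamma>\<close> describes a realization of
    \<open>p\<close> on which all formulas of both kinds fail.\<close>
  define A B where "A = {\<psi> \<in> fms L 2. into_P \<psi> a}"
    and "B = {\<theta> \<in> fms L 2. \<forall>c\<in>P. arrow L M a c \<longrightarrow> \<not> holds M \<theta> [a, c]}"
  let ?\<Gamma> = "p \<union> (\<lambda>\<psi>. (Neg \<psi>, [a])) ` (A \<union> B)"
  have sub: "?\<Gamma> \<subseteq> pfms L 1 {a}"
  proof -
    have "(Neg \<psi>, [a]) \<in> pfms L 1 {a}" if "\<psi> \<in> A \<union> B" for \<psi>
    proof -
      have "\<psi> \<in> fms L 2" using that unfolding A_def B_def by blast
      then show ?thesis by (simp add: pfms_def Neg_in_fms numeral_2_eq_2)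
    qed
    then show ?thesis using p_pfms by blast
  qed
  \<comment> \<open>Avoiding \<open>A\<close> makes \<open>c\<close> a non-successor. The formula
    isolating the type of \<open>(a, c)\<close> then holds at no successor, hence lies in
    \<open>B\<close>, yet it holds at \<open>c\<close>.\<close>
  have "\<not> (\<exists>c\<in>Dom M. \<forall>\<chi>\<in>?\<Gamma>. pholds M \<chi> [c])"
  proof
    assume "\<exists>c\<in>Dom M. \<forall>\<chi>\<in>?\<Gamma>. pholds M \<chi> [c]"
    then obtain c where c: "c \<in> Dom M" "\<forall>\<chi>\<in>?\<Gamma>. pholds M \<chi> [c]" by (rule bexE)
    then have cP: "c \<in> P" using P_iff by blast
    have no: "\<not> holds M \<psi> [a, c]" if "\<psi> \<in> A \<union> B" for \<psi>
    proof -
      have "pholds M (Neg \<psi>, [a]) [c]" using c(2) that by blast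
      then show ?thesis by (simp add: pholds_def holds_def)
    qed
    then have na: "\<not> arrow L M a c" using arrow_iff[OF cP] unfolding A_def by blast
    obtain \<theta> where \<theta>: "\<theta> \<in> fms L 2" "holds M \<theta> [a, c]"
      "\<forall>a'\<in>P. \<forall>b'\<in>P. holds M \<theta> [a', b'] \<longrightarrow> same_type a c a' b'"
      using iso[OF a cP] by blast
    have "\<not> holds M \<theta> [a, c']" if c': "c' \<in> P" "arrow L M a c'" for c'
    proof
      assume "holds M \<theta> [a, c']"
      then have "same_type a c a c'" using \<theta>(3) a c'(1) by blast
      then have "arrow L M a c"
        using c'(2) unfolding arrow_iff[OF c'(1)] arrow_iff[OF cP] same_type_def by blast
      then show False using na by blast
    qed
    then have "\<theta> \<in> B" using \<theta>(1) unfolding B_def by blast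
    then show False using no \<theta>(2) by blast
  qed
  then obtain F where F: "finite F" "F \<subseteq> ?\<Gamma>" "\<not> (\<exists>c\<in>Dom M. \<forall>\<chi>\<in>F. pholds M \<chi> [c])"
    using realize_partial_type[of "{a}" ?\<Gamma>] sub aD by blast
  \<comment> \<open>Finitely many members of \<open>A\<close> suffice: their disjunction
    \<open>\<sigma>\<close> will define semi-isolation.\<close>
  define A' where "A' = {\<psi> \<in> A. (Neg \<psi>, [a]) \<in> F}"
  have "finite A'"
  proof -
    have "inj_on (\<lambda>\<psi>. (Neg \<psi>, [a])) A'" by (rule inj_onI) simp
    moreover have "(\<lambda>\<psi>. (Neg \<psi>, [a])) ` A' \<subseteq> F" unfolding A'_def by blast
    ultimately show ?thesis using F(1) by (rule inj_on_finite)
  qed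
  moreover have "\<psi> \<in> fms L 2" if "\<psi> \<in> A'" for \<psi> using that by (simp add: A'_def A_def)
  ultimately have "dfn L M 2 (\<lambda>e. \<exists>\<psi>\<in>A'. holds M \<psi> [e 0, e 1])"
    by (intro dfn_Bex_finite dfn_holds2) simp_all
  from dfn_2D[of L M "\<lambda>x y. \<exists>\<psi>\<in>A'. holds M \<psi> [x, y]", OF this] obtain \<sigma>
    where \<sigma>: "\<sigma> \<in> fms L 2" "\<forall>x\<in>Dom M. \<forall>y\<in>Dom M. holds M \<sigma> [x, y] \<longleftrightarrow> (\<exists>\<psi>\<in>A'. holds M \<psi> [x, y])"
    by (rule bexE)
  have into_a: "into_P \<sigma> a" unfolding into_P_def
  proof (intro ballI impI)
    fix c assume c: "c \<in> Dom M" "holds M \<sigma> [a, c]"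
    then obtain \<psi> where "\<psi> \<in> A'" "holds M \<psi> [a, c]" using \<sigma>(2) aD by blast
    then show "c \<in> P" using c(1) unfolding A'_def A_def into_P_def by blast
  qed
  \<comment> \<open>A successor on which \<open>\<sigma>\<close> failed would realize all of
    \<open>F\<close>: formulas of \<open>B\<close> fail at successors by definition, and those of
    \<open>A\<close> occurring in \<open>F\<close> are disjuncts of \<open>\<sigma>\<close>.\<close>
  have complete_a: "holds M \<sigma> [a, c]" if c: "c \<in> P" "arrow L M a c" for c
  proof (rule ccontr)
    have cD: "c \<in> Dom M" using c(1) P_Dom by blast
    assume "\<not> holds M \<sigma> [a, c]"
    then have no: "\<not> holds M \<psi> [a, c]" if "\<psi> \<in> A'" for \<psi> using \<sigma>(2) aD cD that by blast
    have "pholds M \<chi> [c]" if \<chi>: "\<chi> \<in> F" for \<chi>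
    proof (cases "\<chi> \<in> p")
      case True
      then show ?thesis using c(1) P_iff by blast
    next
      case False
      then obtain \<psi> where \<psi>: "\<psi> \<in> A \<union> B" "\<chi> = (Neg \<psi>, [a])" using \<chi> F(2) by blast
      have "\<not> holds M \<psi> [a, c]"
      proof (cases "\<psi> \<in> A")
        case True
        then have "\<psi> \<in> A'" using \<chi> \<psi>(2) by (simp add: A'_def)
        then show ?thesis by (rule no)
      next
        case False
        then have "\<psi> \<in> B" using \<psi>(1) by blast
        then show ?thesis using c unfolding B_def by blast
      qed
      then show ?thesis by (simp add: \<psi>(2) pholds_def holds_def)
    qed
    then show False using F(3) cD by blast
  qed
  \<comment> \<open>The description at \<open>a\<close> spreads to every \<open>b\<close> in
    \<open>P\<close>: for each witness \<open>\<psi>\<close> of an arrow from \<open>b\<close>, the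
    implication from \<open>\<psi>\<close> to \<open>\<sigma>\<close> is proved at \<open>a\<close>
    and transferred.\<close>
  have \<sigma>_iff: "holds M \<sigma> [b, c] \<longleftrightarrow> c \<in> P \<and> arrow L M b c" if b: "b \<in> P" and c: "c \<in> Dom M" for b c
  proof
    have into_b: "into_P \<sigma> b" using into_P_transfer[OF \<sigma>(1) a b into_a] .
    assume h: "holds M \<sigma> [b, c]"
    then have "c \<in> P" using into_b c unfolding into_P_def by blast
    then show "c \<in> P \<and> arrow L M b c" using arrow_iff h into_b \<sigma>(1) by blast
  next
    assume h: "c \<in> P \<and> arrow L M b c"
    then obtain \<psi> where \<psi>: "\<psi> \<in> fms L 2" "holds M \<psi> [b, c]" "into_P \<psi> b"
      using arrow_iff by blast
    have \<psi>a: "into_P \<psi> a" using into_P_transfer[OF \<psi>(1) b a \<psi>(3)] .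
    have "dfn L M 1 (\<lambda>e. \<forall>c\<in>Dom M. holds M \<psi> [e 0, c] \<longrightarrow> holds M \<sigma> [e 0, c])"
      by (intro dfn_Ball dfn_imp dfn_holds2 \<psi>(1) \<sigma>(1)) simp_all
    moreover have "\<forall>c\<in>Dom M. holds M \<psi> [a, c] \<longrightarrow> holds M \<sigma> [a, c]"
    proof (intro ballI impI)
      fix c assume c: "c \<in> Dom M" "holds M \<psi> [a, c]"
      then have cP: "c \<in> P" using \<psi>a unfolding into_P_def by blast
      then have "arrow L M a c" using arrow_iff[OF cP] \<psi>(1) c(2) \<psi>a by blast
      then show "holds M \<sigma> [a, c]" using complete_a cP by blast
    qed
    ultimately have "\<forall>c\<in>Dom M. holds M \<psi> [b, c] \<longrightarrow> holds M \<sigma> [b, c]"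
      using transfer_P[of "\<lambda>x. \<forall>c\<in>Dom M. holds M \<psi> [x, c] \<longrightarrow> holds M \<sigma> [x, c]" a b] a b
      by simp
    then show "holds M \<sigma> [b, c]" using c \<psi>(2) by blast
  qed
  \<comment> \<open>The chain runs backwards along strict predecessors, so the sets of successors
    grow with \<open>i\<close>.\<close>
  have "\<exists>s. \<forall>i. s i \<in> P \<and> arrow L M (s (Suc i)) (s i) \<and> \<not> arrow L M (s i) (s (Suc i))"
    using dependent_nat_choice[of "\<lambda>_ x. x \<in> P"
        "\<lambda>_ x y. arrow L M y x \<and> \<not> arrow L M x y"] a pred by blast
  then obtain s where s: "\<And>i. s i \<in> P" "\<And>i. arrow L M (s (Suc i)) (s i)"
    "\<And>i. \<not> arrow L M (s i) (s (Suc i))" by blast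
  have sD: "s i \<in> Dom M" for i using s(1) P_Dom by blast
  let ?X = "\<lambda>i. {xs \<in> tuples (Dom M) 1. holds M \<sigma> ([s i] @ xs)}"
  have mem: "[c] \<in> ?X i \<longleftrightarrow> c \<in> P \<and> arrow L M (s i) c" for i c
    using \<sigma>_iff[OF s(1), of c i] P_Dom[of c] by (auto simp: tuples_def)
  have "?X i \<subset> ?X (Suc i)" for i
  proof
    show "?X i \<subseteq> ?X (Suc i)"
    proof
      fix xs assume xs: "xs \<in> ?X i"
      then have "xs \<in> tuples (Dom M) 1" by blast
      then obtain c where c: "xs = [c]" using tuples_1[of xs "Dom M"] by blast
      then have "c \<in> P" "arrow L M (s i) c" using xs mem[of c i] by simp_all
      then have "arrow L M (s (Suc i)) c" using arrow_trans s(1,2) by blast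
      then show "xs \<in> ?X (Suc i)" using mem[of c "Suc i"] c \<open>c \<in> P\<close> by simp
    qed
    have "[s (Suc i)] \<in> ?X (Suc i)" using mem s(1) arrow_refl by blast
    moreover have "[s (Suc i)] \<notin> ?X i" using mem s(3) by blast
    ultimately show "?X i \<noteq> ?X (Suc i)" by blast
  qed
  moreover have "[s i] \<in> tuples (Dom M) 1" for i using sD by (simp add: tuples_def)
  moreover have "\<sigma> \<in> fms L (1 + 1)" using \<sigma>(1) by (simp add: numeral_2_eq_2)
  ultimately show ?thesis unfolding SOP_def
    by (intro exI[of _ 1] bexI[of _ \<sigma>] exI[of _ "\<lambda>i. [s i]"] conjI allI)
qed

subsection \<open>Isolated types in binary theories\<close>

definition triple :: "'a \<Rightarrow> 'a \<Rightarrow> 'a \<Rightarrow> nat \<Rightarrow> 'a" where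
  "triple d a b i = (if i = 0 then d else if i = 1 then a else b)"

text \<open>A formula in two of the three variables either talks about \<open>(a, b)\<close> or has its truth value
  fixed by \<open>\<psi>\<^sub>1(d, a)\<close> or by \<open>\<psi>\<^sub>2(d, b)\<close>. Variables other than \<open>0\<close> and \<open>1\<close> are all interpreted
  by \<open>b\<close>, since the binary formulas need not have the free variables of the original formula.\<close>

lemma bool_comb_eliminate:
  assumes pr: "principal L M p \<psi>1" "principal L M p \<psi>2"
    and \<beta>: "\<beta> \<in> bool_combs {\<chi>. wf_fm L \<chi> \<and> card (fv \<chi>) \<le> 2}"
  shows "\<exists>\<theta>\<in>fms L 2. \<forall>d\<in>P. \<forall>a\<in>Dom M. \<forall>b\<in>Dom M. holds M \<psi>1 [d, a] \<longrightarrow> holds M \<psi>2 [d, b] \<longrightarrow>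
    (sat M (triple d a b) \<beta> \<longleftrightarrow> holds M \<theta> [a, b])"
  using \<beta>
proof (induction rule: bool_combs.induct)
  case (1 \<chi>)
  then have wf: "wf_fm L \<chi>" and card: "card (fv \<chi>) \<le> 2" by simp_all
  have const: "\<exists>\<theta>\<in>fms L 2. \<forall>a b. holds M \<theta> [a, b] \<longleftrightarrow> B" for B
  proof (cases B)
    case True
    then show ?thesis by (intro bexI[of _ "Neg Fls"]) (simp_all add: holds_def fms_def)
  next
    case False
    then show ?thesis by (intro bexI[of _ Fls]) (simp_all add: holds_def fms_def)
  qed
  \<comment> \<open>The substitution identifies all variables other than \<open>k\<close>, leaving a
    formula in two variables.\<close>
  have two: "\<exists>\<theta>\<in>fms L 2. \<forall>x\<in>Dom M. \<forall>y\<in>Dom M.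
      holds M \<theta> [x, y] \<longleftrightarrow> sat M (\<lambda>i. if i = k then x else y) \<chi>" for k
  proof -
    let ?\<rho> = "\<lambda>i. if i = k then 0 else 1 :: nat"
    have "dfn L M 2 (\<lambda>e. sat M (\<lambda>i. e (?\<rho> i)) \<chi>)" by (rule dfn_sat[OF wf]) auto
    moreover have "(\<lambda>i. e (?\<rho> i)) = (\<lambda>i. if i = k then e 0 else e 1)" for e :: "nat \<Rightarrow> 'a"
      by auto
    ultimately have "dfn L M 2 (\<lambda>e. sat M (\<lambda>i. if i = k then e 0 else e 1) \<chi>)" by simp
    then show ?thesis by (rule dfn_2D[of L M "\<lambda>x y. sat M (\<lambda>i. if i = k then x else y) \<chi>"])
  qed
  from two[of 0] obtain \<theta>0 where \<theta>0: "\<theta>0 \<in> fms L 2" "\<forall>x\<in>Dom M. \<forall>y\<in>Dom M.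
      holds M \<theta>0 [x, y] \<longleftrightarrow> sat M (\<lambda>i. if i = 0 then x else y) \<chi>" by (rule bexE)
  from two[of 1] obtain \<theta>1 where \<theta>1: "\<theta>1 \<in> fms L 2" "\<forall>x\<in>Dom M. \<forall>y\<in>Dom M.
      holds M \<theta>1 [x, y] \<longleftrightarrow> sat M (\<lambda>i. if i = 1 then x else y) \<chi>" by (rule bexE)
  \<comment> \<open>All variables outside \<open>{0, 1}\<close> stand for \<open>b\<close>, so the
    alternatives say that \<open>d\<close>, \<open>a\<close> or \<open>b\<close> respectively does
    not occur.\<close>
  have "0 \<notin> fv \<chi> \<or> 1 \<notin> fv \<chi> \<or> (\<forall>i\<in>fv \<chi>. i = 0 \<or> i = 1)"
  proof (rule ccontr)
    assume "\<not> ?thesis"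
    then obtain i where "{0, 1, i} \<subseteq> fv \<chi>" "i \<noteq> 0" "i \<noteq> 1" by blast
    then have "card {0, 1, i} \<le> card (fv \<chi>)" using card_mono[OF finite_fv] by blast
    then show False using card \<open>i \<noteq> 0\<close> \<open>i \<noteq> 1\<close> by simp
  qed
  then consider "0 \<notin> fv \<chi>" | "1 \<notin> fv \<chi>" | "\<forall>i\<in>fv \<chi>. i = 0 \<or> i = 1" by blast
  then show ?case
  proof cases
    case 1
    have "sat M (triple d a b) \<chi> \<longleftrightarrow> sat M (\<lambda>i. if i = 1 then a else b) \<chi>" for d a b
      by (rule sat_cong) (use 1 in \<open>auto simp: triple_def\<close>)
    then show ?thesis using \<theta>1 by (intro bexI[of _ \<theta>1]) simp_all
  next
    case 2
    have eq: "sat M (triple d a b) \<chi> \<longleftrightarrow> sat M (\<lambda>i. if i = 0 then d else b) \<chi>" for d a b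
      by (rule sat_cong) (use 2 in \<open>auto simp: triple_def\<close>)
    \<comment> \<open>\<open>B\<close> is one truth value for all \<open>d\<close> in
      \<open>P\<close>, so a constant formula serves uniformly.\<close>
    obtain B where "\<forall>d\<in>P. \<forall>b\<in>Dom M. holds M \<psi>2 [d, b] \<longrightarrow> (holds M \<theta>0 [d, b] \<longleftrightarrow> B)"
      using principal_decides[OF pr(2) \<theta>0(1)] by blast
    then have "\<forall>d\<in>P. \<forall>b\<in>Dom M. holds M \<psi>2 [d, b] \<longrightarrow>
        (sat M (\<lambda>i. if i = 0 then d else b) \<chi> \<longleftrightarrow> B)"
      using \<theta>0(2) P_Dom by blast
    moreover from const[of B] obtain \<theta> where "\<theta> \<in> fms L 2" "\<forall>a b. holds M \<theta> [a, b] \<longleftrightarrow> B"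
      by (rule bexE)
    ultimately show ?thesis unfolding eq by (intro bexI[of _ \<theta>]) simp_all
  next
    case 3
    have eq: "sat M (triple d a b) \<chi> \<longleftrightarrow> sat M (\<lambda>i. if i = 0 then d else a) \<chi>" for d a b
      by (rule sat_cong) (use 3 in \<open>auto simp: triple_def\<close>)
    obtain B where "\<forall>d\<in>P. \<forall>a\<in>Dom M. holds M \<psi>1 [d, a] \<longrightarrow> (holds M \<theta>0 [d, a] \<longleftrightarrow> B)"
      using principal_decides[OF pr(1) \<theta>0(1)] by blast
    then have "\<forall>d\<in>P. \<forall>a\<in>Dom M. holds M \<psi>1 [d, a] \<longrightarrow>
        (sat M (\<lambda>i. if i = 0 then d else a) \<chi> \<longleftrightarrow> B)"
      using \<theta>0(2) P_Dom by blast
    moreover from const[of B] obtain \<theta> where "\<theta> \<in> fms L 2" "\<forall>a b. holds M \<theta> [a, b] \<longleftrightarrow> B"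
      by (rule bexE)
    ultimately show ?thesis unfolding eq by (intro bexI[of _ \<theta>]) simp_all
  qed
next
  case (2 \<phi>)
  from "2.IH" obtain \<theta> where \<theta>: "\<theta> \<in> fms L 2" "\<forall>d\<in>P. \<forall>a\<in>Dom M. \<forall>b\<in>Dom M. holds M \<psi>1 [d, a] \<longrightarrow>
    holds M \<psi>2 [d, b] \<longrightarrow> (sat M (triple d a b) \<phi> \<longleftrightarrow> holds M \<theta> [a, b])" by (rule bexE)
  have "holds M (Neg \<theta>) xs \<longleftrightarrow> \<not> holds M \<theta> xs" for xs by (simp add: holds_def)
  then show ?case using \<theta> by (intro bexI[of _ "Neg \<theta>"]) (simp_all add: Neg_in_fms)
next
  case (3 \<phi> \<phi>')
  from "3.IH"(1) obtain \<theta> where \<theta>: "\<theta> \<in> fms L 2" "\<forall>d\<in>P. \<forall>a\<in>Dom M. \<forall>b\<in>Dom M.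
    holds M \<psi>1 [d, a] \<longrightarrow> holds M \<psi>2 [d, b] \<longrightarrow> (sat M (triple d a b) \<phi> \<longleftrightarrow> holds M \<theta> [a, b])"
    by (rule bexE)
  from "3.IH"(2) obtain \<theta>' where \<theta>': "\<theta>' \<in> fms L 2" "\<forall>d\<in>P. \<forall>a\<in>Dom M. \<forall>b\<in>Dom M.
    holds M \<psi>1 [d, a] \<longrightarrow> holds M \<psi>2 [d, b] \<longrightarrow> (sat M (triple d a b) \<phi>' \<longleftrightarrow> holds M \<theta>' [a, b])"
    by (rule bexE)
  have "holds M (Or \<theta> \<theta>') xs \<longleftrightarrow> holds M \<theta> xs \<or> holds M \<theta>' xs" for xs by (simp add: holds_def)
  moreover have "Or \<theta> \<theta>' \<in> fms L 2" using \<theta>(1) \<theta>'(1) by (simp add: fms_def)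
  ultimately show ?case using \<theta>(2) \<theta>'(2) by (intro bexI[of _ "Or \<theta> \<theta>'"]) simp_all
qed

text \<open>The isolating formula becomes some \<open>\<chi>(z, x, y)\<close>; along
  \<open>\<psi>1\<close> and \<open>\<psi>2\<close> binarity turns it into a condition
  \<open>\<theta>(x, y)\<close> free of \<open>z\<close>. That \<open>\<chi>(d, x, y)\<close>
  implies each formula of the type of \<open>(a, b)\<close> is definable in \<open>d\<close>, so it
  transfers to every other \<open>d'\<close>.\<close>

lemma isolating_formula:
  assumes bin: "\<And>\<chi>. wf_fm L \<chi> \<Longrightarrow> \<exists>\<beta>\<in>bool_combs {\<chi>. wf_fm L \<chi> \<and> card (fv \<chi>) \<le> 2}.
      \<forall>e. range e \<subseteq> Dom M \<longrightarrow> (sat M e \<chi> \<longleftrightarrow> sat M e \<beta>)"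
    and pr: "principal L M p \<psi>1" "principal L M p \<psi>2"
    and d: "d \<in> P" and ab: "a \<in> Dom M" "b \<in> Dom M"
    and \<psi>: "holds M \<psi>1 [d, a]" "holds M \<psi>2 [d, b]"
    and iso: "isolated L M 2 {d} (tp L M [a, b] {d})"
  shows "\<exists>\<theta>\<in>fms L 2. holds M \<theta> [a, b] \<and> (\<forall>d'\<in>P. \<forall>a'\<in>Dom M. \<forall>b'\<in>Dom M.
    holds M \<psi>1 [d', a'] \<longrightarrow> holds M \<psi>2 [d', b'] \<longrightarrow> holds M \<theta> [a', b'] \<longrightarrow> same_type a b a' b')"
proof -
  have dD: "d \<in> Dom M" using d P_Dom by blast
  obtain \<xi> where \<xi>: "\<xi> \<in> pfms L 2 {d}" "isolates M 2 \<xi> (tp L M [a, b] {d})"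
    using iso unfolding isolated_def by blast
  obtain \<zeta> cs where \<zeta>: "\<xi> = (\<zeta>, cs)" by (cases \<xi>)
  have cs: "set cs \<subseteq> {d}" "\<zeta> \<in> fms L (length cs + 2)" using \<xi>(1) by (simp_all add: \<zeta> pfms_def)
  let ?k = "length cs"
  \<comment> \<open>The parameter list \<open>cs\<close> repeats \<open>d\<close>, possibly zero
    times; \<open>?\<rho>\<close> merges all its slots into variable \<open>0\<close>.\<close>
  let ?\<rho> = "\<lambda>i. if i < ?k then 0 else if i = ?k then 1 else 2 :: nat"
  let ?R = "\<lambda>z x y. sat M (\<lambda>i. if i < ?k then z else if i = ?k then x else y) \<zeta>"
  have "dfn L M 3 (\<lambda>e. sat M (\<lambda>i. e (?\<rho> i)) \<zeta>)"
    by (rule dfn_sat) (use cs(2) in \<open>auto simp: fms_def\<close>)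
  moreover have "(\<lambda>i. e (?\<rho> i)) = (\<lambda>i. if i < ?k then e 0 else if i = ?k then e 1 else e 2)"
    for e :: "nat \<Rightarrow> 'a" by auto
  ultimately have "dfn L M 3 (\<lambda>e. ?R (e 0) (e 1) (e 2))" by simp
  from dfn_3D[of L M ?R, OF this] obtain \<chi> where \<chi>: "\<chi> \<in> fms L 3"
    "\<forall>z\<in>Dom M. \<forall>x\<in>Dom M. \<forall>y\<in>Dom M. holds M \<chi> [z, x, y] \<longleftrightarrow> ?R z x y" by (rule bexE)
  have \<chi>_iff: "holds M \<chi> [d, x, y] \<longleftrightarrow> pholds M \<xi> [x, y]" if xy: "x \<in> Dom M" "y \<in> Dom M" for x y
  proof -
    have "holds M \<zeta> (cs @ [x, y]) \<longleftrightarrow> ?R d x y"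
    proof (rule holds_iff_sat)
      show "\<zeta> \<in> fms L (length (cs @ [x, y]))" using cs(2) by simp
      show "(if i < ?k then d else if i = ?k then x else y) = (cs @ [x, y]) ! i"
        if i: "i < length (cs @ [x, y])" for i
      proof -
        consider "i < ?k" | "i = ?k" | "i = Suc ?k" using i by force
        then show ?thesis
        proof cases
          case 1
          then have "cs ! i = d" using cs(1) nth_mem by blast
          then show ?thesis using 1 by (simp add: nth_append)
        qed (simp_all add: nth_append)
      qed
    qed
    then show ?thesis using \<chi>(2) dD xy by (simp add: \<zeta> pholds_def)
  qed
  have iso_ab: "xs \<in> realizations M 2 (tp L M [a, b] {d})"
    if "xs \<in> tuples (Dom M) 2" "pholds M \<xi> xs" for xs
    using \<xi>(2) that unfolding isolates_def by blast
  have \<chi>_same: "holds M \<theta> [x, y]"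
    if \<theta>: "\<theta> \<in> fms L 2" "holds M \<theta> [a, b]" and xy: "x \<in> Dom M" "y \<in> Dom M" "holds M \<chi> [d, x, y]"
    for \<theta> x y
  proof -
    have "(\<theta>, []) \<in> tp L M [a, b] {d}"
      using \<theta> by (simp add: tp_def pfms_def pholds_def numeral_2_eq_2)
    moreover have "[x, y] \<in> realizations M 2 (tp L M [a, b] {d})"
      using xy \<chi>_iff by (intro iso_ab) (simp_all add: tuples_def)
    ultimately have "pholds M (\<theta>, []) [x, y]" unfolding realizations_def by blast
    then show ?thesis by (simp add: pholds_def)
  qed
  have \<chi>_ab: "holds M \<chi> [d, a, b]"
  proof -
    obtain xs where xs: "xs \<in> tuples (Dom M) 2" "pholds M \<xi> xs"
      using \<xi>(2) unfolding isolates_def by blast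
    \<comment> \<open>If \<open>\<xi>\<close> failed at \<open>(a, b)\<close>, its negation would
      belong to the type that \<open>\<xi>\<close> isolates and so hold at
      \<open>xs\<close>.\<close>
    have "pholds M \<xi> [a, b]"
    proof (rule ccontr)
      assume "\<not> pholds M \<xi> [a, b]"
      then have "(Neg \<zeta>, cs) \<in> tp L M [a, b] {d}"
        using cs by (simp add: tp_def \<zeta> pfms_def pholds_def holds_def Neg_in_fms numeral_2_eq_2)
      then have "pholds M (Neg \<zeta>, cs) xs" using iso_ab[OF xs] unfolding realizations_def by blast
      then show False using xs(2) by (simp add: \<zeta> pholds_def holds_def)
    qed
    then show ?thesis using \<chi>_iff ab by blast
  qed
  have wf\<chi>: "wf_fm L \<chi>" using \<chi>(1) by (simp add: fms_def)
  from bin[OF this] obtain \<beta> where \<beta>: "\<beta> \<in> bool_combs {\<chi>. wf_fm L \<chi> \<and> card (fv \<chi>) \<le> 2}"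
    "\<forall>e. range e \<subseteq> Dom M \<longrightarrow> (sat M e \<chi> \<longleftrightarrow> sat M e \<beta>)" by (rule bexE)
  from bool_comb_eliminate[OF pr \<beta>(1)] obtain \<theta> where \<theta>: "\<theta> \<in> fms L 2"
    "\<forall>d\<in>P. \<forall>a\<in>Dom M. \<forall>b\<in>Dom M. holds M \<psi>1 [d, a] \<longrightarrow> holds M \<psi>2 [d, b] \<longrightarrow>
      (sat M (triple d a b) \<beta> \<longleftrightarrow> holds M \<theta> [a, b])" by (rule bexE)
  have \<theta>_iff: "holds M \<theta> [y, z] \<longleftrightarrow> holds M \<chi> [x, y, z]"
    if h: "x \<in> P" "y \<in> Dom M" "z \<in> Dom M" "holds M \<psi>1 [x, y]" "holds M \<psi>2 [x, z]" for x y z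
  proof -
    have "holds M \<theta> [y, z] \<longleftrightarrow> sat M (triple x y z) \<beta>" using \<theta>(2) h by blast
    also have "\<dots> \<longleftrightarrow> sat M (triple x y z) \<chi>"
    proof -
      have "range (triple x y z) \<subseteq> Dom M" using h P_Dom by (auto simp: triple_def)
      then show ?thesis using \<beta>(2) by blast
    qed
    also have "\<dots> \<longleftrightarrow> holds M \<chi> [x, y, z]"
      by (rule holds_iff_sat[symmetric])
        (use \<chi>(1) in \<open>auto simp: triple_def numeral_3_eq_3 less_Suc_eq\<close>)
    finally show ?thesis .
  qed
  have "same_type a b y z"
    if h: "x \<in> P" "y \<in> Dom M" "z \<in> Dom M" "holds M \<psi>1 [x, y]" "holds M \<psi>2 [x, z]"
      "holds M \<theta> [y, z]" for x y z
  proof -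
    have "holds M \<chi> [x, y, z]" using h \<theta>_iff by blast
    have imp: "holds M \<eta> [y, z]" if \<eta>: "\<eta> \<in> fms L 2" "holds M \<eta> [a, b]" for \<eta>
    proof -
      let ?Q = "\<lambda>d. \<forall>x\<in>Dom M. \<forall>y\<in>Dom M. holds M \<chi> [d, x, y] \<longrightarrow> holds M \<eta> [x, y]"
      have "dfn L M 1 (\<lambda>e. ?Q (e 0))"
        by (intro dfn_Ball dfn_imp dfn_holds3 dfn_holds2 \<chi>(1) \<eta>(1)) simp_all
      moreover have "?Q d" using \<chi>_same[OF \<eta>] by blast
      ultimately have "?Q x" using transfer_P[of ?Q d x] d h(1) by blast
      then show ?thesis using h(2,3) \<open>holds M \<chi> [x, y, z]\<close> by blast
    qed
    have "holds M \<eta> [a, b] \<longleftrightarrow> holds M \<eta> [y, z]" if \<eta>: "\<eta> \<in> fms L 2" for \<eta>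
    proof (cases "holds M \<eta> [a, b]")
      case False
      then have "holds M (Neg \<eta>) [y, z]" using \<eta> by (intro imp) (simp_all add: Neg_in_fms holds_def)
      then show ?thesis using False by (simp add: holds_def)
    qed (use imp \<eta> in blast)
    then show ?thesis unfolding same_type_def by blast
  qed
  moreover have "holds M \<theta> [a, b]" using \<theta>_iff[OF d ab \<psi>] \<chi>_ab by blast
  ultimately show ?thesis using \<theta>(1) by blast
qed

subsection \<open>The space of pairs\<close>

lemma realization_mem_iff:
  assumes "q \<in> types L M 2 {}" "[a, b] \<in> realizations M 2 q" "\<theta> \<in> fms L 2"
  shows "(\<theta>, []) \<in> q \<longleftrightarrow> holds M \<theta> [a, b]"
proof -
  have real: "pholds M \<chi> [a, b]" if "\<chi> \<in> q" for \<chi>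
    using assms(2) that unfolding realizations_def by blast
  have "(\<theta>, []) \<in> q \<or> (Neg \<theta>, []) \<in> q"
    using assms(1) pfms_emptyI[OF assms(3)] unfolding types_iff by blast
  then show ?thesis
    using real[of "(\<theta>, [])"] real[of "(Neg \<theta>, [])"] by (auto simp: pholds_def holds_def)
qed

lemma type_eqI:
  assumes "q \<in> types L M 2 {}" "r \<in> types L M 2 {}" "\<And>\<theta>. \<theta> \<in> fms L 2 \<Longrightarrow> (\<theta>, []) \<in> q \<longleftrightarrow> (\<theta>, []) \<in> r"
  shows "q = r"
proof (rule set_eqI)
  fix \<chi>
  have sub: "q \<subseteq> pfms L 2 {}" "r \<subseteq> pfms L 2 {}" using assms(1,2) unfolding types_iff by blast+
  show "\<chi> \<in> q \<longleftrightarrow> \<chi> \<in> r"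
  proof (cases "\<chi> \<in> pfms L 2 {}")
    case True
    then obtain \<theta> where "\<theta> \<in> fms L 2" "\<chi> = (\<theta>, [])" by (rule pfms_emptyE)
    then show ?thesis using assms(3) by simp
  next
    case False
    then show ?thesis using sub by blast
  qed
qed

text \<open>The labels of \<open>q\<close> are the index pairs \<open>(i, j)\<close> with
  \<open>q\<close> in \<open>C\<^sub>i\<^sub>j\<close>, at most \<open>n\<^sup>2\<close> many. PGPIP
  makes \<open>q\<close> isolated in one of these sets, and closedness keeps new labels away from a
  neighbourhood.\<close>

lemma pair_space_rank:
  fixes \<phi> :: "nat \<Rightarrow> ('f, 'r) fm" and n :: nat
  assumes bin: "\<And>\<chi>. wf_fm L \<chi> \<Longrightarrow> \<exists>\<beta>\<in>bool_combs {\<chi>. wf_fm L \<chi> \<and> card (fv \<chi>) \<le> 2}.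
      \<forall>e. range e \<subseteq> Dom M \<longrightarrow> (sat M e \<chi> \<longleftrightarrow> sat M e \<beta>)"
    and n: "n > 0"
    and pr: "\<And>i. i \<in> {1..n} \<Longrightarrow> principal L M p (\<phi> i)"
    and pgpip: "\<And>a b. a \<in> P \<Longrightarrow> b \<in> P \<Longrightarrow> \<exists>d\<in>P. isolated L M 2 {d} (tp L M [a, b] {d}) \<and>
      (\<exists>i\<in>{1..n}. holds M (\<phi> i) [d, a]) \<and> (\<exists>j\<in>{1..n}. holds M (\<phi> j) [d, b])"
  shows "cb_rank (pair_space L M p) < enat (n\<^sup>2)"
proof -
  let ?I = "{1..n} \<times> {1..n}"
  let ?X = "pair_space L M p"
  let ?Y = "{q \<in> types L M 2 {}. p \<union> (\<lambda>(\<phi>, cs). (ren (transpose 0 1) \<phi>, cs)) ` p \<subseteq> q}"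
  define C where "C i j a b \<longleftrightarrow> (\<exists>d\<in>P. holds M (\<phi> i) [d, a] \<and> holds M (\<phi> j) [d, b])" for i j a b
  define K where "K q = {(i, j) \<in> ?I. \<exists>a\<in>Dom M. \<exists>b\<in>Dom M. [a, b] \<in> realizations M 2 q \<and> C i j a b}"
    for q
  have fms\<phi>: "\<phi> i \<in> fms L 2" if "i \<in> {1..n}" for i using pr[OF that] by (simp add: principal_def)
  have top: "topspace ?X \<subseteq> ?Y" by (simp add: pair_space_def)
  have realize: "\<exists>a\<in>P. \<exists>b\<in>P. [a, b] \<in> realizations M 2 q" if q: "q \<in> ?Y" for q
  proof -
    have qt: "q \<in> types L M 2 {}" and pq: "p \<subseteq> q"
      and pq': "(\<lambda>(\<phi>, cs). (ren (transpose 0 1) \<phi>, cs)) ` p \<subseteq> q" using q by simp_all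
    obtain a b where ab: "[a, b] \<in> realizations M 2 q" using qt by (rule realize_2_type)
    then have D: "a \<in> Dom M" "b \<in> Dom M" by (simp_all add: realizations_def tuples_def)
    have real: "pholds M \<chi> [a, b]" if "\<chi> \<in> q" for \<chi>
      using ab that unfolding realizations_def by blast
    have "pholds M \<chi> [a] \<and> pholds M \<chi> [b]" if \<chi>: "\<chi> \<in> p" for \<chi>
    proof -
      obtain \<pi> where \<pi>: "\<pi> \<in> fms L 1" "\<chi> = (\<pi>, [])" using \<chi> by (rule p_memE)
      have "(\<pi>, []) \<in> q" "(ren (transpose 0 1) \<pi>, []) \<in> q"
        using pq pq' \<chi> \<pi>(2) by force+
      then have h: "sat M (nth [a, b]) \<pi>" "sat M (nth [a, b]) (ren (transpose 0 1) \<pi>)"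
        using real[of "(\<pi>, [])"] real[of "(ren (transpose 0 1) \<pi>, [])"]
        by (simp_all add: pholds_def holds_def)
      have "sat M (nth [a, b]) \<pi> \<longleftrightarrow> sat M (nth [a]) \<pi>"
        by (rule sat_cong) (use \<pi>(1) in \<open>auto simp: fms_def\<close>)
      \<comment> \<open>Exchanging the variables makes \<open>\<pi>\<close> speak about the second
        coordinate, so the copy \<open>p(y)\<close> inside \<open>q\<close> yields that
        \<open>b\<close> realizes \<open>p\<close>.\<close>
      moreover have "sat M (nth [a, b]) (ren (transpose 0 1) \<pi>) \<longleftrightarrow>
          sat M (\<lambda>i. [a, b] ! transpose 0 1 i) \<pi>" by (rule sat_ren) simp
      moreover have "sat M (\<lambda>i. [a, b] ! transpose 0 1 i) \<pi> \<longleftrightarrow> sat M (nth [b]) \<pi>"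
        by (rule sat_cong) (use \<pi>(1) in \<open>auto simp: fms_def\<close>)
      ultimately show ?thesis using h by (simp add: \<pi>(2) pholds_def holds_def)
    qed
    then show ?thesis using ab D P_iff by blast
  qed
  have "cb_rank ?X < enat (card ?I)"
  proof (rule cb_rank_less_card[where K = K])
    show "finite ?I" by simp
    show "?I \<noteq> {}" using n by simp
    show "K q \<subseteq> ?I" for q unfolding K_def by blast
  next
    fix q assume "q \<in> topspace ?X"
    then have q: "q \<in> ?Y" using top by blast
    from realize[OF q] obtain a b where ab: "a \<in> P" "b \<in> P" "[a, b] \<in> realizations M 2 q"
      by (elim bexE)
    obtain d i j where d: "d \<in> P" "isolated L M 2 {d} (tp L M [a, b] {d})" "i \<in> {1..n}" "j \<in> {1..n}"
      "holds M (\<phi> i) [d, a]" "holds M (\<phi> j) [d, b]" using pgpip[OF ab(1,2)] by blast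
    then have "C i j a b" unfolding C_def by blast
    then have "(i, j) \<in> K q" using d(3,4) ab P_Dom unfolding K_def by blast
    then show "K q \<noteq> {}" by blast
  next
    fix q assume "q \<in> topspace ?X"
    then have q: "q \<in> ?Y" using top by blast
    then have qt: "q \<in> types L M 2 {}" by simp
    from realize[OF q] obtain a b where ab: "a \<in> P" "b \<in> P" "[a, b] \<in> realizations M 2 q"
      by (elim bexE)
    have D: "a \<in> Dom M" "b \<in> Dom M" using ab P_Dom by blast+
    obtain d i j where d: "d \<in> P" "isolated L M 2 {d} (tp L M [a, b] {d})" "i \<in> {1..n}" "j \<in> {1..n}"
      "holds M (\<phi> i) [d, a]" "holds M (\<phi> j) [d, b]" using pgpip[OF ab(1,2)] by blast
    have "C i j a b" using d(1,5,6) unfolding C_def by blast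
    then have ijK: "(i, j) \<in> K q" using d(3,4) ab(3) D unfolding K_def by blast
    obtain \<theta> where \<theta>: "\<theta> \<in> fms L 2" "holds M \<theta> [a, b]" "\<forall>d'\<in>P. \<forall>a'\<in>Dom M. \<forall>b'\<in>Dom M.
      holds M (\<phi> i) [d', a'] \<longrightarrow> holds M (\<phi> j) [d', b'] \<longrightarrow> holds M \<theta> [a', b'] \<longrightarrow> same_type a b a' b'"
      using isolating_formula[OF bin pr[OF d(3)] pr[OF d(4)] d(1) D d(5,6,2)] by blast
    \<comment> \<open>Each label that \<open>q\<close> lacks is excluded by a formula true at
      \<open>(a, b)\<close>. Finitely many labels allow the conjunction with
      \<open>\<theta>\<close>, which defines the neighbourhood \<open>?U\<close>.\<close>
    have "\<forall>k\<in>?I - K q. \<exists>\<eta>\<in>fms L 2. holds M \<eta> [a, b] \<and>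
      (\<forall>a'\<in>Dom M. \<forall>b'\<in>Dom M. holds M \<eta> [a', b'] \<longrightarrow> \<not> C (fst k) (snd k) a' b')"
    proof
      fix k assume k: "k \<in> ?I - K q"
      obtain k1 k2 where k12: "k = (k1, k2)" by (cases k)
      then have kI: "k1 \<in> {1..n}" "k2 \<in> {1..n}" "(k1, k2) \<notin> K q" using k by simp_all
      then have "\<not> C k1 k2 a b" using D ab(3) unfolding K_def by blast
      then show "\<exists>\<eta>\<in>fms L 2. holds M \<eta> [a, b] \<and>
        (\<forall>a'\<in>Dom M. \<forall>b'\<in>Dom M. holds M \<eta> [a', b'] \<longrightarrow> \<not> C (fst k) (snd k) a' b')"
        using co_predecessor_closed[OF fms\<phi>[OF kI(1)] fms\<phi>[OF kI(2)] D]
        by (simp add: C_def k12)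
    qed
    then obtain \<eta> where \<eta>: "\<forall>k\<in>?I - K q. \<eta> k \<in> fms L 2 \<and> holds M (\<eta> k) [a, b] \<and>
      (\<forall>a'\<in>Dom M. \<forall>b'\<in>Dom M. holds M (\<eta> k) [a', b'] \<longrightarrow> \<not> C (fst k) (snd k) a' b')"
      unfolding Bex_def by (rule bchoice[THEN exE])
    let ?R = "\<lambda>x y. holds M \<theta> [x, y] \<and> (\<forall>k\<in>?I - K q. holds M (\<eta> k) [x, y])"
    have "dfn L M 2 (\<lambda>e. ?R (e 0) (e 1))"
      by (intro dfn_and dfn_Ball_finite dfn_holds2 \<theta>(1)) (use \<eta> in simp_all)
    from dfn_2D[of L M ?R, OF this] obtain \<xi> where \<xi>: "\<xi> \<in> fms L 2"
      "\<forall>x\<in>Dom M. \<forall>y\<in>Dom M. holds M \<xi> [x, y] \<longleftrightarrow> ?R x y" by (rule bexE)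
    let ?U = "{r \<in> types L M 2 {}. (\<xi>, []) \<in> r}"
    have "openin (type_space L M 2 {}) ?U" unfolding type_space_def
      by (rule topology_generated_by_Basis, rule image_eqI[OF refl pfms_emptyI[OF \<xi>(1)]])
    then have "openin ?X (?U \<inter> ?Y)" unfolding pair_space_def openin_subtopology by blast
    moreover have "q \<in> ?U \<inter> ?Y"
    proof -
      have "holds M \<xi> [a, b]" using \<xi>(2) D \<theta>(2) \<eta> by blast
      then show ?thesis using realization_mem_iff[OF qt ab(3) \<xi>(1)] qt q by blast
    qed
    moreover have "K r \<subset> K q" if r: "r \<in> ?U \<inter> ?Y" "r \<noteq> q" for r
    proof -
      have rt: "r \<in> types L M 2 {}" "(\<xi>, []) \<in> r" using r(1) by blast+
      have rR: "?R x y" if "x \<in> Dom M" "y \<in> Dom M" "[x, y] \<in> realizations M 2 r" for x y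
        using realization_mem_iff[OF rt(1) that(3) \<xi>(1)] rt(2) \<xi>(2) that(1,2) by blast
      have "K r \<subseteq> K q"
      proof (rule subrelI)
        fix k1 k2 assume k: "(k1, k2) \<in> K r"
        show "(k1, k2) \<in> K q"
        proof (rule ccontr)
          assume "(k1, k2) \<notin> K q"
          then have kI: "(k1, k2) \<in> ?I - K q" using k unfolding K_def by blast
          obtain x y where xy: "x \<in> Dom M" "y \<in> Dom M" "[x, y] \<in> realizations M 2 r" "C k1 k2 x y"
            using k unfolding K_def by blast
          then have "holds M (\<eta> (k1, k2)) [x, y]" using rR kI by blast
          then have "\<not> C k1 k2 x y" using \<eta>[rule_format, OF kI] xy(1,2) by simp
          then show False using xy(4) by blast
        qed
      qed
      \<comment> \<open>Within \<open>C i j\<close> the formula \<open>\<theta>\<close> pins down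
        the type of \<open>(a, b)\<close>, so only \<open>q\<close> itself keeps this label.\<close>
      moreover have "(i, j) \<notin> K r"
      proof
        assume "(i, j) \<in> K r"
        then obtain x y where xy: "x \<in> Dom M" "y \<in> Dom M" "[x, y] \<in> realizations M 2 r" "C i j x y"
          unfolding K_def by blast
        then have "same_type a b x y" using rR[OF xy(1-3)] \<theta>(3) unfolding C_def by blast
        then have "r = q" using rt(1) qt
          realization_mem_iff[OF rt(1) xy(3)] realization_mem_iff[OF qt ab(3)]
          unfolding same_type_def by (intro type_eqI) simp_all
        then show False using r(2) by blast
      qed
      ultimately show ?thesis using ijK by blast
    qed
    ultimately show "\<exists>U. openin ?X U \<and> q \<in> U \<and> (\<forall>r\<in>U. r \<noteq> q \<longrightarrow> K r \<subset> K q)" by meson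
  qed
  then show ?thesis by (simp add: card_cartesian_product power2_eq_square)
qed

text \<open>With one principal formula, every pair from \<open>P\<close> has a common predecessor
  along it, so the relative isolation of \<open>isolating_formula\<close> becomes isolation on all
  of \<open>P\<close>. Strict predecessors come from PGPIP applied to \<open>(a, a)\<close>.\<close>

lemma SOP_if_single_principal:
  assumes bin: "\<And>\<chi>. wf_fm L \<chi> \<Longrightarrow> \<exists>\<beta>\<in>bool_combs {\<chi>. wf_fm L \<chi> \<and> card (fv \<chi>) \<le> 2}.
      \<forall>e. range e \<subseteq> Dom M \<longrightarrow> (sat M e \<chi> \<longleftrightarrow> sat M e \<beta>)"
    and pr: "principal L M p \<psi>"
    and pgpip: "\<And>a b. a \<in> P \<Longrightarrow> b \<in> P \<Longrightarrow> \<exists>d\<in>P. isolated L M 2 {d} (tp L M [a, b] {d}) \<and>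
      holds M \<psi> [d, a] \<and> holds M \<psi> [d, b]"
  shows "SOP L M"
proof (rule SOP_if_pairs_isolated)
  fix a b assume ab: "a \<in> P" "b \<in> P"
  have D: "a \<in> Dom M" "b \<in> Dom M" using ab P_Dom by blast+
  obtain d where d: "d \<in> P" "isolated L M 2 {d} (tp L M [a, b] {d})" "holds M \<psi> [d, a]"
    "holds M \<psi> [d, b]" using pgpip[OF ab] by blast
  obtain \<theta> where \<theta>: "\<theta> \<in> fms L 2" "holds M \<theta> [a, b]" "\<forall>d'\<in>P. \<forall>a'\<in>Dom M. \<forall>b'\<in>Dom M.
    holds M \<psi> [d', a'] \<longrightarrow> holds M \<psi> [d', b'] \<longrightarrow> holds M \<theta> [a', b'] \<longrightarrow> same_type a b a' b'"
    using isolating_formula[OF bin pr pr d(1) D d(3,4,2)] by blast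
  have "same_type a b a' b'" if "a' \<in> P" "b' \<in> P" "holds M \<theta> [a', b']" for a' b'
    using pgpip[OF that(1,2)] \<theta>(3) that P_Dom by blast
  then show "\<exists>\<theta>\<in>fms L 2. holds M \<theta> [a, b] \<and>
      (\<forall>a'\<in>P. \<forall>b'\<in>P. holds M \<theta> [a', b'] \<longrightarrow> same_type a b a' b')"
    using \<theta>(1,2) by blast
next
  fix a assume "a \<in> P"
  then show "\<exists>d\<in>P. arrow L M d a \<and> \<not> arrow L M a d"
    using pgpip[of a a] principal_arrow[OF pr] principal_not_arrow[OF pr] by blast
qed

end

section \<open>Application to the monster model\<close>

theorem theorem5p2:
  fixes L :: "('f, 'r) lang"
    and T :: "('f, 'r) fm set"
    and M :: "('a, 'f, 'r) struct"
    and \<kappa> :: "'k rel"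
    and p :: "('a, 'f, 'r) pfm set"
    and \<phi> :: "nat \<Rightarrow> ('f, 'r) fm"
    and n :: nat
  assumes "countable_lang L"
    and "complete_theory TYPE('a) L T"
    and "monster \<kappa> L T M"
    and "small_theory L M"
    and "binary_theory TYPE('a) L T"
    and "\<not> SOP L M"
    and "p \<in> types L M 1 {}"
    and "powerful L M 1 p"
    and "\<And>i. i \<in> {1..n} \<Longrightarrow> principal L M p (\<phi> i)"
    and "witnesses_PGPIP L M p (Disj (map \<phi> [1..<Suc n]))"
  shows "n \<ge> 2 \<and> cb_rank (pair_space L M p) < enat (n\<^sup>2)"
proof -
  interpret type_in_saturated L M p
  proof
    fix A :: "'a set" and q assume A: "finite A" "A \<subseteq> Dom M" "q \<in> types L M 1 A"
    \<comment> \<open>Finite parameter sets are below the uncountable \<open>\<kappa>\<close>, so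
      monster saturation gives the locale assumption.\<close>
    have "|A| <o natLeq" using A(1) finite_iff_ordLess_natLeq by blast
    moreover have "natLeq <o \<kappa>" using assms(3) unfolding monster_def by blast
    ultimately have "|A| <o \<kappa>" by (rule ordLess_transitive)
    then show "realizations M 1 q \<noteq> {}" using assms(3) A(2,3) unfolding monster_def by blast
  qed (rule assms(7))
  have bin: "\<exists>\<beta>\<in>bool_combs {\<chi>. wf_fm L \<chi> \<and> card (fv \<chi>) \<le> 2}.
      \<forall>e. range e \<subseteq> Dom M \<longrightarrow> (sat M e \<chi> \<longleftrightarrow> sat M e \<beta>)" if wf: "wf_fm L \<chi>" for \<chi>
  proof -
    obtain \<beta> where \<beta>: "\<beta> \<in> bool_combs {\<chi>. wf_fm L \<chi> \<and> card (fv \<chi>) \<le> 2}"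
      "entails TYPE('a) L T (Iff \<chi> \<beta>)"
      using assms(5) wf unfolding binary_theory_def by blast
    \<comment> \<open>The equivalence modulo \<open>T\<close> is evaluated in \<open>M\<close>,
      itself one of the models over which \<open>entails\<close> quantifies.\<close>
    have "is_model L T M" using assms(3) unfolding monster_def by blast
    then have "sat M e (Iff \<chi> \<beta>)" if "range e \<subseteq> Dom M" for e
      using \<beta>(2) that unfolding entails_def by blast
    moreover have "sat M e (Iff \<chi> \<beta>) \<longleftrightarrow> (sat M e \<chi> \<longleftrightarrow> sat M e \<beta>)" for e
      by (auto simp: Iff_def)
    ultimately show ?thesis using \<beta>(1) by blast
  qed
  have Disj_iff: "holds M (Disj (map \<phi> [1..<Suc n])) xs \<longleftrightarrow> (\<exists>i\<in>{1..n}. holds M (\<phi> i) xs)" for xs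
    unfolding holds_Disj set_map set_upt atLeastLessThanSuc_atLeastAtMost by blast
  have pgpip: "\<exists>d\<in>P. isolated L M 2 {d} (tp L M [a, b] {d}) \<and>
      (\<exists>i\<in>{1..n}. holds M (\<phi> i) [d, a]) \<and> (\<exists>j\<in>{1..n}. holds M (\<phi> j) [d, b])"
    if "a \<in> P" "b \<in> P" for a b
    using assms(10) that unfolding witnesses_PGPIP_def Disj_iff by blast
  \<comment> \<open>For \<open>n = 0\<close> the disjunction is \<open>Fls\<close>, but PGPIP at
    \<open>(a, a)\<close> requires it to hold somewhere.\<close>
  have "n \<noteq> 0"
  proof
    assume "n = 0"
    moreover obtain a where "a \<in> P" using P_nonempty by blast
    ultimately show False using pgpip[of a a] by auto
  qed
  moreover have "n \<noteq> 1"
  proof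
    assume "n = 1"
    then have "principal L M p (\<phi> 1)" using assms(9) by simp
    moreover have "\<exists>d\<in>P. isolated L M 2 {d} (tp L M [a, b] {d}) \<and>
      holds M (\<phi> 1) [d, a] \<and> holds M (\<phi> 1) [d, b]" if "a \<in> P" "b \<in> P" for a b
      using pgpip[OF that] \<open>n = 1\<close> by simp
    ultimately have "SOP L M" using bin SOP_if_single_principal by blast
    then show False using assms(6) by blast
  qed
  ultimately show ?thesis using pair_space_rank[OF bin _ assms(9) pgpip] by simp
qed

end
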